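(* Let $\eta$ be a positive real function on $[2,\infty)$ and let $\mathcal{A}=\{a_n\}_{n\ge1}$ be a strictly increasing sequence of positive integers such that, for some constants $K_1,\dots,K_4>0$ and all $x\ge 2$: $K_1 x/\eta(x)\le\mathcal{A}(x)\le K_2 x/\eta(x)$, $\mathcal{A}(x/2)\ge K_3\mathcal{A}(x)$, and $\mathcal{A}(x,r)\le K_4\frac{r}{\varphi(r)}\frac{x}{\eta(x)^2}$ for every positive integer $r$. Let $a\ge2$ be an integer and $f(n)=\gamma_d n^d+\dots+\gamma_0$ a polynomial with integer coefficients, $\gamma_d>0$, $\gcd(\gamma_d,\dots,\gamma_0)=1$, and $f(\mathbb{N})\subseteq\mathbb{N}$. Let $r(n)=\#\{(k,m)\in\mathbb{N}^2: a_k+a^{f(m)}=n\}$. Then there exist positive constants $x_0,c_1,c_2$ depending only on $a$, $f$ and $K_1,\dots,K_4$ such that for all $x\ge x_0$, \[ \#\Big\{n\le x: r(n)\ge c_1\frac{(\log x)^{1/d}}{\eta(x)}\Big\}\ge c_2\,x\,\frac{(\log x)^{1/d}}{(\log x)^{1/d}+\eta(x)}. \]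
   Context: $\mathcal{A}(x)=\#\{n: a_n\le x\}$, $\mathcal{A}(x,r)=\#\{n: a_n\le x,\ a_n+r\in\mathcal{A}\}$; $\varphi$ is Euler's totient function. *)

theory Defs
  imports
    Complex_Main
    "HOL-Computational_Algebra.Polynomial"
    "HOL-Number_Theory.Totient"
begin

text \<open>
  The positive integers are represented inside the type \<^typ>\<open>nat\<close>: a sequence
  $(a_n)_{n \ge 1}$ is a function on \<^typ>\<open>nat\<close> whose value at \<open>0\<close> is irrelevant.
\<close>

definition pos_strict_seq :: "(nat \<Rightarrow> nat) \<Rightarrow> bool" where
  "pos_strict_seq A \<longleftrightarrow> strict_mono_on {1..} A \<and> (\<forall>n\<ge>1. A n > 0)"

definition seq_count :: "(nat \<Rightarrow> nat) \<Rightarrow> real \<Rightarrow> nat" where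
  "seq_count A x = card {n. n \<ge> 1 \<and> real (A n) \<le> x}"

definition seq_shift_count :: "(nat \<Rightarrow> nat) \<Rightarrow> real \<Rightarrow> nat \<Rightarrow> nat" where
  "seq_shift_count A x r = card {n. n \<ge> 1 \<and> real (A n) \<le> x \<and> A n + r \<in> A ` {1..}}"

text \<open>
  The truncation \<^const>\<open>nat\<close> is harmless for polynomials that map positive integers to
  positive integers, since only arguments \<open>m \<ge> 1\<close> occur.
\<close>

definition repr_count :: "(nat \<Rightarrow> nat) \<Rightarrow> nat \<Rightarrow> int poly \<Rightarrow> nat \<Rightarrow> nat" where
  "repr_count A a f n =
     card {(k, m). k \<ge> 1 \<and> m \<ge> 1 \<and> A k + a ^ nat (poly f (int m)) = n}"

end

theory Submission
  imports Defs "HOL-Number_Theory.Pocklington"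
begin

text \<open>
  Romanoff's method. Restrict to $m \le N$ with $N$ of order $(\log x)^{1/d}$ and to $a_k \le x/2$. The
  number of sums $a_k + a^{f(m)}$ is at least a constant times $xN/\eta(x)$, and the claim follows by Cauchy-Schwarz once the
  number of coincidences $a_k + a^{f(m)} = a_{k'} + a^{f(m')}$ is shown to be at most a constant times
  $xN/\eta(x) + xN^2/\eta(x)^2$. By the hypothesis on $\mathcal{A}(x,r)$ it suffices that
  $h(a^{f(m')-f(m)} - 1)$ is bounded on average over $m, m' \le N$, where
  $h(n) = n/\varphi(n) = \prod_{p \mid n} (1 + 1/(p-1))$.

  Expanding the product turns the average into a sum over squarefree $e$, coprime to $a$, of
  $1/\varphi(e)$ times the proportion of pairs with $\mathrm{ord}_e(a) \mid f(m') - f(m)$. Writing $t$ for this order, the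
  proportion is $O(t^{-\delta})$ with $\delta = 2/(d(d+1))$, because an interval of length $L$ containing more than $d$
  zeros of a degree $d$ polynomial modulo $t$ has $L^{d(d+1)/2} \gg t$. On the other hand the $e$
  with order at most $T$ are composed of the $O(T^2)$ primes dividing $\prod_{t \le T} (a^t - 1)$, so by Chebyshev's
  estimate the sum of $1/\varphi(e)$ over them grows only like a power of $\log T$, and a dyadic
  decomposition according to the order gives convergence.
\<close>

section \<open>Euler products over sets of primes\<close>

lemma prod_primes_dvd:
  fixes n :: nat
  assumes "finite P" and "\<And>p. p \<in> P \<Longrightarrow> prime p \<and> p dvd n"
  shows "\<Prod>P dvd n"
  using assms
proof (induction P rule: finite_induct)
  case (insert p P)
  have "coprime p (\<Prod>P)"
    using insert.hyps insert.prems by (intro prod_coprime_right) (auto intro!: primes_coprime)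
  then show ?case
    using insert by (auto intro!: divides_mult)
qed simp

text \<open>A prime in (n, 2n] divides (2n)! but not n!, so it divides the central binomial
  coefficient, which is at most 4^n. The product of these primes divides it too, and each of them
  exceeds n.\<close>

lemma power_card_primes_between:
  fixes n :: nat
  assumes "n \<ge> 1"
  shows "n ^ card {p. prime p \<and> n < p \<and> p \<le> 2 * n} \<le> 4 ^ n"
proof -
  define P where "P = {p. prime p \<and> n < p \<and> p \<le> 2 * n}"
  have fin: "finite P"
    by (rule finite_subset[of _ "{..2 * n}"]) (auto simp: P_def)
  have "prime p \<and> p dvd (2 * n choose n)" if "p \<in> P" for p
  proof -
    have p: "prime p" "n < p" "p \<le> 2 * n"
      using that by (auto simp: P_def)
    have "p dvd fact n * fact n * (2 * n choose n)"
      using p binomial_fact_lemma[of n "2 * n"] by (simp add: prime_dvd_fact_iff mult_2)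
    moreover have "\<not> p dvd fact n"
      using p by (simp add: prime_dvd_fact_iff)
    ultimately show ?thesis
      using p by (simp add: prime_dvd_mult_iff)
  qed
  then have "\<Prod>P dvd (2 * n choose n)"
    using fin by (intro prod_primes_dvd) auto
  then have "\<Prod>P \<le> (2 * n choose n)"
    by (rule dvd_imp_le) (simp add: zero_less_binomial_iff)
  moreover have "n ^ card P \<le> \<Prod>P"
    using prod_mono[of P "\<lambda>_. n" "\<lambda>p. p"] by (auto simp: P_def)
  moreover have "(2 * n choose n) \<le> 4 ^ n"
    using binomial_le_pow2[of "2 * n" n] by (simp add: power_mult)
  ultimately show ?thesis
    unfolding P_def by linarith
qed

text \<open>The case n = 2^k, after comparing exponents of 2: Chebyshev's bound 2^(k+1)/k for a
  dyadic block, with the denominator multiplied out so that k = 0 is covered.\<close>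

lemma card_primes_dyadic:
  "k * card {p. prime p \<and> 2 ^ k < p \<and> p \<le> (2 :: nat) ^ Suc k} \<le> 2 ^ Suc k"
proof -
  define c where "c = card {p. prime p \<and> 2 ^ k < p \<and> p \<le> (2 :: nat) ^ Suc k}"
  have "((2 :: nat) ^ k) ^ c \<le> 4 ^ (2 ^ k)"
    using power_card_primes_between[of "2 ^ k"] by (simp add: c_def)
  also have "(4 :: nat) ^ (2 ^ k) = 2 ^ (2 ^ Suc k)"
    using power_mult[of "2 :: nat" 2 "2 ^ k"] by (simp only: power_Suc) simp
  finally have "(2 :: nat) ^ (k * c) \<le> 2 ^ (2 ^ Suc k)"
    by (simp only: power_mult)
  then show ?thesis
    unfolding c_def by (simp only: power_increasing_iff[of 2] numeral_less_iff)
qed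

section \<open>Mertens-type upper bounds for products over primes\<close>

text \<open>The product of p/(p-1), which is n/phi(n) when \<open>Q\<close> is the set of prime
  factors of n. The form 1 + 1/(p-1) is the one that expands over subsets of
  \<open>Q\<close>.\<close>

definition euler_prod :: "nat set \<Rightarrow> real" where
  "euler_prod Q = (\<Prod>p\<in>Q. 1 + 1 / (real p - 1))"

lemma euler_prod_ge_1:
  assumes "\<And>p. p \<in> Q \<Longrightarrow> p \<ge> 2"
  shows "euler_prod Q \<ge> 1"
  unfolding euler_prod_def
proof (rule prod_ge_1)
  fix p assume "p \<in> Q"
  then have "real p \<ge> 2" using assms by force
  then show "1 \<le> 1 + 1 / (real p - 1)" by simp
qed

lemma euler_prod_mono:
  assumes "finite Q'" "Q \<subseteq> Q'" "\<And>p. p \<in> Q' \<Longrightarrow> p \<ge> 2"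
  shows "euler_prod Q \<le> euler_prod Q'"
proof -
  have "euler_prod Q' = euler_prod Q * euler_prod (Q' - Q)"
    unfolding euler_prod_def using prod.subset_diff[OF assms(2,1)] by (simp add: mult.commute)
  moreover have "euler_prod Q \<ge> 1" "euler_prod (Q' - Q) \<ge> 1"
    using assms by (auto intro!: euler_prod_ge_1)
  ultimately show ?thesis
    by (smt (verit) mult_left_le mult_le_cancel_left1)
qed

lemma euler_prod_union:
  assumes "finite P" "finite Q" "P \<inter> Q = {}"
  shows "euler_prod (P \<union> Q) = euler_prod P * euler_prod Q"
  unfolding euler_prod_def using assms by (rule prod.union_disjoint)

text \<open>Since p - 1 \<ge> m, every factor is at most 1 + 1/m \<le> exp(1/m).\<close>

lemma euler_prod_le_exp:
  assumes "m \<ge> 1" "\<And>p. p \<in> Q \<Longrightarrow> p > m"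
  shows "euler_prod Q \<le> exp (real (card Q) / real m)"
proof -
  have "euler_prod Q \<le> (\<Prod>p\<in>Q. exp (1 / real m))"
    unfolding euler_prod_def
  proof (rule prod_mono)
    fix p assume "p \<in> Q"
    then have "real p - 1 \<ge> real m" using assms(2)[of p] by linarith
    then have "1 / (real p - 1) \<le> 1 / real m" "1 / (real p - 1) \<ge> 0"
      using assms(1) by (auto intro!: frac_le)
    then show "0 \<le> 1 + 1 / (real p - 1) \<and> 1 + 1 / (real p - 1) \<le> exp (1 / real m)"
      using exp_ge_add_one_self[of "1 / real m"] by linarith
  qed
  also have "\<dots> = exp (real (card Q) / real m)"
    by (simp flip: exp_of_nat_mult)
  finally show ?thesis .
qed

text \<open>Makes the dyadic induction telescope: one block will contribute at most a quotient of
  consecutive fourth powers. The exponent 4 comes from 2/k \<le> 4/(k+1), combined with exp(1/(k+1))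
  \<le> (k+1)/k.\<close>

lemma exp_two_div_le:
  assumes "k \<ge> 1"
  shows "exp (2 / real k) \<le> (real (Suc k) / real k) ^ 4"
proof -
  have "1 - 1 / real (Suc k) \<le> exp (- (1 / real (Suc k)))"
    using exp_ge_add_one_self[of "- (1 / real (Suc k))"] by simp
  moreover have "1 - 1 / real (Suc k) = real k / real (Suc k)"
    by (simp add: field_simps)
  ultimately have "real k / real (Suc k) \<le> inverse (exp (1 / real (Suc k)))"
    by (simp add: exp_minus)
  then have "exp (1 / real (Suc k)) \<le> real (Suc k) / real k"
    using assms by (simp add: field_simps)
  then have "exp (1 / real (Suc k)) ^ 4 \<le> (real (Suc k) / real k) ^ 4"
    by (rule power_mono) simp
  moreover have "exp (2 / real k) \<le> exp (1 / real (Suc k)) ^ 4"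
    using assms by (simp add: field_simps flip: exp_of_nat_mult)
  ultimately show ?thesis by linarith
qed

text \<open>A weak form of Mertens' theorem, with the fourth power of the logarithm instead of the
  first. By Chebyshev's bound the primes between 2^(k+1) and 2^(k+2) contribute at most
  exp(2/(k+1)), and these contributions telescope.\<close>

lemma euler_prod_primes_le:
  "euler_prod {p. prime p \<and> p \<le> 2 ^ Suc k} \<le> 2 * real (Suc k) ^ 4"
proof (induction k)
  case 0
  have "{p :: nat. prime p \<and> p \<le> 2 ^ Suc 0} = {2}"
    using prime_ge_2_nat by (auto intro: antisym)
  then show ?case by (simp add: euler_prod_def)
next
  case (Suc k)
  let ?B = "{p :: nat. prime p \<and> 2 ^ Suc k < p \<and> p \<le> 2 ^ Suc (Suc k)}"
  have fin: "finite {p :: nat. prime p \<and> p \<le> 2 ^ j}" for j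
    by (rule finite_subset[of _ "{..2 ^ j}"]) auto
  have finB: "finite ?B"
    by (rule finite_subset[OF _ fin[of "Suc (Suc k)"]]) auto
  have "x \<le> 2 ^ Suc (Suc k)" if "x \<le> 2 ^ Suc k" for x :: nat
    using that by (rule order.trans) simp
  then have split: "{p. prime p \<and> p \<le> (2::nat) ^ Suc (Suc k)} = {p. prime p \<and> p \<le> 2 ^ Suc k} \<union> ?B"
    by (auto simp del: power_Suc)
  have "euler_prod ?B \<le> exp (real (card ?B) / real (2 ^ Suc k))"
    by (rule euler_prod_le_exp) auto
  also have "real (card ?B) / real (2 ^ Suc k) \<le> 2 / real (Suc k)"
  proof -
    have "real (Suc k * card ?B) \<le> real (2 ^ Suc (Suc k))"
      using card_primes_dyadic[of "Suc k"] by (simp only: of_nat_le_iff)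
    then show ?thesis by (simp add: field_simps)
  qed
  then have "exp (real (card ?B) / real (2 ^ Suc k)) \<le> exp (2 / real (Suc k))" by simp
  also have "\<dots> \<le> (real (Suc (Suc k)) / real (Suc k)) ^ 4"
    by (rule exp_two_div_le) simp
  finally have B: "euler_prod ?B \<le> (real (Suc (Suc k)) / real (Suc k)) ^ 4" .
  have "euler_prod {p. prime p \<and> p \<le> (2::nat) ^ Suc (Suc k)}
      = euler_prod {p. prime p \<and> p \<le> 2 ^ Suc k} * euler_prod ?B"
    unfolding split by (rule euler_prod_union) (use fin[of "Suc k"] finB in auto)
  also have "\<dots> \<le> (2 * real (Suc k) ^ 4) * (real (Suc (Suc k)) / real (Suc k)) ^ 4"
    using Suc.IH B euler_prod_ge_1[of ?B]
    by (intro mult_mono) (auto intro!: order.trans[OF _ euler_prod_ge_1] dest: prime_ge_2_nat)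
  also have "\<dots> = 2 * real (Suc (Suc k)) ^ 4"
    by (simp add: power_divide del: of_nat_Suc)
  finally show ?case .
qed

text \<open>Primes up to 2^(k+1) are covered by \<open>euler_prod_primes_le\<close>. The others
  number at most 2^(k+1) and each exceeds 2^(k+1), so together they contribute at most e <
  3.\<close>

lemma euler_prod_le_card:
  assumes "finite Q" "\<And>p. p \<in> Q \<Longrightarrow> prime p" "card Q \<le> 2 ^ Suc k"
  shows "euler_prod Q \<le> 6 * real (Suc k) ^ 4"
proof -
  let ?S = "{p :: nat. prime p \<and> p \<le> 2 ^ Suc k}"
  let ?L = "{p \<in> Q. 2 ^ Suc k < p}"
  have finS: "finite ?S"
    by (rule finite_subset[of _ "{..2 ^ Suc k}"]) auto
  have "euler_prod Q \<le> euler_prod (?S \<union> ?L)"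
  proof (rule euler_prod_mono)
    show "finite (?S \<union> ?L)" using finS assms(1) by (auto simp del: power_Suc)
    show "Q \<subseteq> ?S \<union> ?L" using assms(2) by force
    show "p \<ge> 2" if "p \<in> ?S \<union> ?L" for p
      using that assms(2) prime_ge_2_nat[of p] by auto
  qed
  also have "\<dots> = euler_prod ?S * euler_prod ?L"
    by (rule euler_prod_union) (use finS assms(1) in auto)
  also have "\<dots> \<le> (2 * real (Suc k) ^ 4) * 3"
  proof (rule mult_mono)
    have "card ?L \<le> 2 ^ Suc k"
      using card_mono[OF assms(1), of ?L] assms(3) by auto
    then have "real (card ?L) \<le> real (2 ^ Suc k)" by (simp only: of_nat_le_iff)
    then have "real (card ?L) / real (2 ^ Suc k) \<le> 1" by (simp del: power_Suc)
    then have "exp (real (card ?L) / real (2 ^ Suc k)) \<le> exp 1"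
      by (simp only: exp_le_cancel_iff)
    moreover have "euler_prod ?L \<le> exp (real (card ?L) / real (2 ^ Suc k))"
      by (rule euler_prod_le_exp) auto
    ultimately show "euler_prod ?L \<le> 3"
      using exp_le by linarith
    show "0 \<le> euler_prod ?L"
      using assms(2) by (intro order.trans[OF _ euler_prod_ge_1]) (auto dest: prime_ge_2_nat)
  qed (use euler_prod_primes_le in auto)
  finally show ?thesis by simp
qed

section \<open>Multiplicative orders\<close>

text \<open>If \<open>p\<close> and \<open>a\<close> are not coprime, \<open>ord p a\<close> is 0 by
  convention and the right-hand side is 0, so the divisibility persists.\<close>

lemma dvd_power_ord_minus_1:
  fixes a p :: nat
  assumes "a \<ge> 1"
  shows "p dvd a ^ ord p a - 1"
  using ord_works[of a p] assms by (metis cong_to_1_nat)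

text \<open>Every prime of \<open>Q\<close> divides the product of a^t - 1 over t \<le> 2^k, which
  is at most a^(4^k); as every prime is at least 2, \<open>card Q\<close> is at most a * 4^k. The
  factor \<open>a\<close> is rounded up to 2^a because \<open>euler_prod_le_card\<close> expects a
  power of two.\<close>

lemma card_primes_ord_le:
  fixes a :: nat
  assumes a: "a \<ge> 2" and Q: "finite Q" "\<And>p. p \<in> Q \<Longrightarrow> prime p \<and> coprime p a \<and> ord p a \<le> 2 ^ k"
  shows "card Q \<le> 2 ^ (a + 2 * k)"
proof -
  let ?P = "\<Prod>t\<in>{1..2 ^ k}. a ^ t - 1"
  have pos: "a ^ t - 1 > 0" if "t \<ge> 1" for t
    using a that one_less_power[of a t] by simp
  have "\<Prod>Q dvd ?P"
  proof (rule prod_primes_dvd[OF Q(1)])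
    fix p assume "p \<in> Q"
    then have p: "prime p" "coprime p a" "ord p a \<le> 2 ^ k" using Q(2) by auto
    then have "ord p a \<in> {1..2 ^ k}" using ord_gt_0_iff[of p a] by (simp add: Suc_le_eq del: ord_gt_0_iff)
    then have "a ^ ord p a - 1 dvd ?P" by (intro dvd_prodI) auto
    with dvd_power_ord_minus_1[of a p] show "prime p \<and> p dvd ?P"
      using p(1) a by (auto intro: dvd_trans)
  qed
  moreover have "?P > 0" by (rule prod_pos) (use pos in auto)
  ultimately have "\<Prod>Q \<le> ?P" by (rule dvd_imp_le)
  moreover have "2 ^ card Q \<le> \<Prod>Q"
    using prod_mono[of Q "\<lambda>_. 2" "\<lambda>p. p"] Q(2) by (auto dest: prime_ge_2_nat)
  moreover have "?P \<le> (\<Prod>t\<in>{1..2 ^ k :: nat}. a ^ 2 ^ k)"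
    using a by (intro prod_mono) (auto intro!: order.trans[OF diff_le_self] power_increasing)
  moreover have "(\<Prod>t\<in>{1..2 ^ k :: nat}. a ^ 2 ^ k) = a ^ (2 ^ k * 2 ^ k)"
    by (simp add: power_mult)
  moreover have "a ^ (2 ^ k * 2 ^ k) \<le> (2 ^ a) ^ (2 ^ k * 2 ^ k)"
    by (intro power_mono) (simp_all add: less_imp_le)
  ultimately have "(2 :: nat) ^ card Q \<le> 2 ^ (a * (2 ^ k * 2 ^ k))"
    unfolding power_mult by linarith
  then have "card Q \<le> a * (2 ^ k * 2 ^ k)" by simp
  also have "\<dots> \<le> 2 ^ a * (2 ^ k * 2 ^ k)"
    by (intro mult_right_mono) (simp_all add: less_imp_le)
  also have "\<dots> = 2 ^ (a + 2 * k)" by (simp add: power_add mult_2)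
  finally show ?thesis .
qed

section \<open>Expansion of n/phi(n) for differences of powers of \<open>a\<close>\<close>

lemma prime_set_prod_dvd_iff:
  fixes n :: nat
  assumes "finite S" "\<And>p. p \<in> S \<Longrightarrow> prime p" "n > 0"
  shows "\<Prod>S dvd n \<longleftrightarrow> S \<subseteq> prime_factors n"
proof
  assume "\<Prod>S dvd n"
  then show "S \<subseteq> prime_factors n"
    using assms by (auto simp: in_prime_factors_iff intro: dvd_trans[OF dvd_prodI])
next
  assume "S \<subseteq> prime_factors n"
  then show "\<Prod>S dvd n"
    using assms by (intro prod_primes_dvd) auto
qed

lemma dvd_power_minus_1_iff_ord:
  fixes a m :: nat
  assumes "a \<ge> 1"
  shows "m dvd a ^ j - 1 \<longleftrightarrow> ord m a dvd j"
proof -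
  have "[a ^ j = 1] (mod m) \<longleftrightarrow> m dvd a ^ j - 1"
    using assms by (subst cong_altdef_nat) simp_all
  then show ?thesis using ord_divides[of a j m] by simp
qed

text \<open>Here and below a set \<open>S\<close> of primes encodes the squarefree number e =
  \<open>\<Prod>S\<close>, and its weight is 1/phi(e).\<close>

lemma euler_prod_eq_sum:
  assumes "finite Q"
  shows "euler_prod Q = (\<Sum>S\<in>Pow Q. \<Prod>p\<in>S. 1 / (real p - 1))"
  unfolding euler_prod_def using prod_add[OF assms, of "\<lambda>p. 1 / (real p - 1)" "\<lambda>_. 1"]
  by (simp add: add.commute)

text \<open>e divides a^j - 1 exactly when the order of \<open>a\<close> modulo e divides
  \<open>j\<close>. Allowing a larger \<open>Q\<close> lets one index set serve many values of
  \<open>j\<close>. If \<open>\<Prod>S\<close> is not coprime to \<open>a\<close>, the order is 0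
  and does not divide j \<ge> 1.\<close>

lemma euler_prod_prime_factors_eq_sum:
  fixes a :: nat
  assumes "a \<ge> 2" "j \<ge> 1" "finite Q" "\<And>p. p \<in> Q \<Longrightarrow> prime p" "prime_factors (a ^ j - 1) \<subseteq> Q"
  shows "euler_prod (prime_factors (a ^ j - 1)) =
    (\<Sum>S\<in>Pow Q. if ord (\<Prod>S) a dvd j then \<Prod>p\<in>S. 1 / (real p - 1) else 0)"
proof -
  have pos: "a ^ j - 1 > 0"
    using assms one_less_power[of a j] by simp
  have "ord (\<Prod>S) a dvd j \<longleftrightarrow> S \<subseteq> prime_factors (a ^ j - 1)" if "S \<subseteq> Q" for S
  proof -
    have "finite S" "\<And>p. p \<in> S \<Longrightarrow> prime p"
      using that assms finite_subset by blast+
    then have "\<Prod>S dvd a ^ j - 1 \<longleftrightarrow> S \<subseteq> prime_factors (a ^ j - 1)"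
      using pos by (rule prime_set_prod_dvd_iff)
    then show ?thesis
      using assms(1) dvd_power_minus_1_iff_ord[of a "\<Prod>S" j] by linarith
  qed
  then have "Pow (prime_factors (a ^ j - 1)) = {S \<in> Pow Q. ord (\<Prod>S) a dvd j}"
    using assms(5) by blast
  then show ?thesis
    using assms(3) by (simp add: euler_prod_eq_sum sum.If_cases Int_def)
qed

lemma over_totient_eq_euler_prod:
  assumes "n > 0"
  shows "real n / real (totient n) = euler_prod (prime_factors n)"
proof -
  have "(\<Prod>p\<in>prime_factors n. 1 - 1 / real p) * euler_prod (prime_factors n)
      = (\<Prod>p\<in>prime_factors n. (1 - 1 / real p) * (1 + 1 / (real p - 1)))"
    by (simp add: euler_prod_def prod.distrib)
  also have "\<dots> = (\<Prod>p\<in>prime_factors n. 1)"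
  proof (rule prod.cong)
    fix p assume "p \<in> prime_factors n"
    then have "real p \<ge> 2" using prime_ge_2_nat by (force dest: in_prime_factors_imp_prime)
    then show "(1 - 1 / real p) * (1 + 1 / (real p - 1)) = 1" by (simp add: field_simps)
  qed simp
  finally have "(\<Prod>p\<in>prime_factors n. 1 - 1 / real p) * euler_prod (prime_factors n) = 1" by simp
  moreover have "real (totient n) = real n * (\<Prod>p\<in>prime_factors n. 1 - 1 / real p)"
    by (rule totient_formula2)
  ultimately have "real (totient n) * euler_prod (prime_factors n) = real n"
    by simp
  moreover have "totient n > 0" using assms by simp
  ultimately show ?thesis
    by (simp add: field_simps)
qed

text \<open>The difference is a^e (a^j - 1) with coprime factors, and n/phi(n) depends only on the
  primes dividing n. Hence a^e contributes a constant that depends on \<open>a\<close>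
  alone.\<close>

lemma over_totient_power_diff:
  fixes a e j :: nat
  assumes "a \<ge> 2" "e \<ge> 1" "j \<ge> 1"
  shows "real (a ^ (e + j) - a ^ e) / real (totient (a ^ (e + j) - a ^ e))
    = euler_prod (prime_factors a) * euler_prod (prime_factors (a ^ j - 1))"
proof -
  have pos: "a ^ j - 1 > 0" "a ^ e > 0"
    using assms one_less_power[of a j] by simp_all
  have eq: "a ^ (e + j) - a ^ e = a ^ e * (a ^ j - 1)"
    by (simp add: power_add right_diff_distrib')
  have "prime_factors (a ^ e * (a ^ j - 1)) = prime_factors a \<union> prime_factors (a ^ j - 1)"
    using pos assms by (simp add: prime_factors_product prime_factors_power)
  moreover have "prime_factors a \<inter> prime_factors (a ^ j - 1) = {}"
  proof (safe)
    fix p assume "p \<in> prime_factors a" "p \<in> prime_factors (a ^ j - 1)"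
    then have p: "prime p" "p dvd a" "p dvd a ^ j - 1" by auto
    then have "p dvd a ^ j" using assms(3) by (simp add: prime_dvd_power_iff)
    then have "p dvd a ^ j - (a ^ j - 1)" using p(3) by (rule dvd_diff_nat)
    moreover have "a ^ j - (a ^ j - 1) = 1" using pos by linarith
    ultimately have "p dvd 1" by (simp only:)
    then show "p \<in> {}" using p(1) by simp
  qed
  ultimately show ?thesis
    using pos by (simp add: eq over_totient_eq_euler_prod euler_prod_union del: of_nat_mult of_nat_diff)
qed

text \<open>Trades linear growth in \<open>k\<close> for exp(u k) with \<open>u\<close> as small as
  wished, so that a fixed power of it can be absorbed by geometric decay.\<close>

lemma linear_le_exp:
  assumes "u > 0" "u \<le> (1 :: real)" "b \<ge> (2 :: real)"
  shows "b + 2 * real k \<le> b / u * exp (u * real k)"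
proof -
  have "b + 2 * real k \<le> b / u * (1 + u * real k)"
  proof -
    have "b \<le> b / u" using assms by (simp add: field_simps)
    moreover have "2 * real k \<le> b * real k" using assms by (intro mult_right_mono) auto
    moreover have "b / u * (1 + u * real k) = b / u + b * real k"
      using assms by (simp add: field_simps)
    ultimately show ?thesis by linarith
  qed
  also have "\<dots> \<le> b / u * exp (u * real k)"
    using assms by (intro mult_left_mono) (auto simp: add.commute intro: order.trans[OF _ exp_ge_add_one_self])
  finally show ?thesis .
qed

text \<open>Uniformity in \<open>Q\<close> amounts to convergence of the series over all squarefree
  e coprime to \<open>a\<close>. Sets are grouped by the \<open>k\<close> for which the order lies
  in [2^k, 2^(k+1)). The primes in such a set have order at most 2^(k+1), so few primes occur and
  the weights sum to at most a polynomial in \<open>k\<close>, against a factor 2^(-\<delta>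
  k).\<close>

lemma ord_weighted_sum_bounded:
  fixes a :: nat and \<delta> :: real
  assumes a: "a \<ge> 2" and \<delta>: "\<delta> > 0"
  shows "\<exists>C>0. \<forall>Q. finite Q \<longrightarrow> (\<forall>p\<in>Q. prime p \<and> coprime p a) \<longrightarrow>
    (\<Sum>S\<in>Pow Q. (\<Prod>p\<in>S. 1 / (real p - 1)) * real (ord (\<Prod>S) a) powr (- \<delta>)) \<le> C"
proof -
  \<comment> \<open>With this \<open>u\<close>, 2^(-\<delta> k) is at most exp(-8 u k). The bound
    exp(u k) from \<open>linear_le_exp\<close> enters to the fourth power, so exp(-4 u k) remains
    and \<open>c\<close> is geometric.\<close>
  define u where "u = min 1 (\<delta> * ln 2 / 8)"
  have u: "u > 0" "u \<le> 1" "8 * u \<le> \<delta> * ln 2"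
    using \<delta> by (auto simp: u_def)
  define M where "M = 6 * (real (a + 2) / u) ^ 4"
  define c where "c = (\<lambda>k::nat. M * exp (- 4 * u) ^ k)"
  have M: "M > 0" using u by (simp add: M_def)
  have sc: "summable c"
    unfolding c_def using u by (intro summable_mult summable_geometric) simp
  have c_pos: "c k > 0" for k using M by (simp add: c_def)
  show ?thesis
  proof (intro exI[of _ "suminf c"] conjI allI impI)
    show "suminf c > 0" by (rule suminf_pos[OF sc c_pos])
  next
    fix Q :: "nat set"
    assume fin: "finite Q" and Q: "\<forall>p\<in>Q. prime p \<and> coprime p a"
    define w where "w = (\<lambda>S::nat set. \<Prod>p\<in>S. 1 / (real p - 1))"
    define \<theta> where "\<theta> = (\<lambda>S. ord (\<Prod>S) a)"
    have wpos: "w S \<ge> 0" if "S \<subseteq> Q" for S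
      unfolding w_def
    proof (rule prod_nonneg)
      fix p assume "p \<in> S"
      then have "p \<ge> 1" using that Q prime_ge_1_nat[of p] by blast
      then show "0 \<le> 1 / (real p - 1)" by simp
    qed
    have \<theta>pos: "\<theta> S \<ge> 1" if "S \<subseteq> Q" for S
    proof -
      have "coprime (\<Prod>S) a"
        using that Q by (intro prod_coprime_left) auto
      then show ?thesis by (simp add: \<theta>_def Suc_le_eq)
    qed
    have "\<exists>k. 2 ^ k \<le> \<theta> S \<and> \<theta> S < 2 ^ Suc k" if "S \<subseteq> Q" for S
      using ex_power_ivl1[of 2 "\<theta> S"] \<theta>pos[OF that] by auto
    then obtain \<kappa> where \<kappa>: "2 ^ \<kappa> S \<le> \<theta> S \<and> \<theta> S < 2 ^ Suc (\<kappa> S)" if "S \<subseteq> Q" for S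
      by metis
    have inner: "(\<Sum>S | S \<in> Pow Q \<and> \<kappa> S = k. w S * real (\<theta> S) powr (- \<delta>)) \<le> c k" for k
    proof -
      define R where "R = {p \<in> Q. ord p a \<le> 2 ^ Suc k}"
      have "S \<in> Pow R" if "S \<in> Pow Q" "\<kappa> S = k" for S
      proof -
        have "ord p a \<le> 2 ^ Suc k" if "p \<in> S" for p
        proof -
          have "finite S" using \<open>S \<in> Pow Q\<close> fin by (auto intro: finite_subset)
          then have "p dvd \<Prod>S" using that by (intro dvd_prodI)
          then have "p dvd a ^ \<theta> S - 1"
            using dvd_power_ord_minus_1[of a "\<Prod>S"] a unfolding \<theta>_def
            by (auto intro: dvd_trans)
          then have "ord p a dvd \<theta> S" using a dvd_power_minus_1_iff_ord[of a p] by simp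
          then have "ord p a \<le> \<theta> S"
            using \<theta>pos[of S] \<open>S \<in> Pow Q\<close> by (intro dvd_imp_le) auto
          then show ?thesis using \<kappa>[of S] \<open>S \<in> Pow Q\<close> \<open>\<kappa> S = k\<close> by auto
        qed
        then show ?thesis using \<open>S \<in> Pow Q\<close> by (auto simp: R_def)
      qed
      then have sub: "{S \<in> Pow Q. \<kappa> S = k} \<subseteq> Pow R" by auto
      have "(\<Sum>S | S \<in> Pow Q \<and> \<kappa> S = k. w S * real (\<theta> S) powr (- \<delta>))
          \<le> (\<Sum>S | S \<in> Pow Q \<and> \<kappa> S = k. w S * exp (- 8 * u) ^ k)"
      proof (intro sum_mono mult_left_mono)
        fix S assume S: "S \<in> {S \<in> Pow Q. \<kappa> S = k}"
        then have "2 ^ k \<le> \<theta> S" using \<kappa>[of S] by auto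
        then have "(2::real) ^ k \<le> real (\<theta> S)"
          by (metis of_nat_le_iff of_nat_numeral of_nat_power)
        then have "real (\<theta> S) powr (- \<delta>) \<le> (2 ^ k) powr (- \<delta>)"
          using \<delta> by (intro powr_mono2') auto
        also have "\<dots> = exp (- (\<delta> * ln 2) * real k)"
          by (simp add: powr_def ln_realpow algebra_simps)
        also have "\<dots> \<le> exp (- (8 * u) * real k)"
        proof -
          have "8 * u * real k \<le> \<delta> * ln 2 * real k"
            using u(3) by (intro mult_right_mono) auto
          then show ?thesis by simp
        qed
        also have "\<dots> = exp (- 8 * u) ^ k" by (simp add: mult.commute flip: exp_of_nat_mult)
        finally show "real (\<theta> S) powr (- \<delta>) \<le> exp (- 8 * u) ^ k" .
      qed (use wpos in auto)
      \<comment> \<open>Admitting all subsets of \<open>R\<close>, whatever their order, turns the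
        sum of weights back into an Euler product.\<close>
      also have "\<dots> \<le> (\<Sum>S\<in>Pow R. w S * exp (- 8 * u) ^ k)"
        using fin sub by (intro sum_mono2) (auto simp: R_def intro!: mult_nonneg_nonneg wpos)
      also have "\<dots> = euler_prod R * exp (- 8 * u) ^ k"
        using fin by (simp add: R_def w_def euler_prod_eq_sum sum_distrib_right)
      also have "\<dots> \<le> (6 * real (a + 2 * Suc k) ^ 4) * exp (- 8 * u) ^ k"
      proof (rule mult_right_mono)
        have "card R \<le> 2 ^ (a + 2 * Suc k)"
          using fin Q by (intro card_primes_ord_le[OF a]) (auto simp: R_def)
        then have "card R \<le> 2 ^ Suc (a + 2 * k + 1)" by simp
        then show "euler_prod R \<le> 6 * real (a + 2 * Suc k) ^ 4"
          using fin Q euler_prod_le_card[of R "a + 2 * k + 1"] by (auto simp: R_def)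
      qed simp
      \<comment> \<open>\<open>linear_le_exp\<close> is used with b = a + 2, as a + 2(k+1) = (a + 2)
        + 2k.\<close>
      also have "\<dots> \<le> (6 * (real (a + 2) / u * exp (u * real k)) ^ 4) * exp (- 8 * u) ^ k"
        using linear_le_exp[OF u(1,2), of "real (a + 2)" k]
        by (intro mult_right_mono mult_left_mono power_mono) auto
      also have "\<dots> = M * (exp (u * real k) ^ 4 * exp (- 8 * u) ^ k)"
        by (simp only: M_def power_mult_distrib)
      also have "exp (u * real k) ^ 4 * exp (- 8 * u) ^ k = exp (- 4 * u) ^ k"
        by (simp add: algebra_simps flip: exp_of_nat_mult exp_add)
      finally show ?thesis by (simp add: c_def)
    qed
    have "(\<Sum>S\<in>Pow Q. w S * real (\<theta> S) powr (- \<delta>))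
        = (\<Sum>k\<in>\<kappa> ` Pow Q. \<Sum>S | S \<in> Pow Q \<and> \<kappa> S = k. w S * real (\<theta> S) powr (- \<delta>))"
      using fin by (intro sum.image_gen) simp
    also have "\<dots> \<le> (\<Sum>k\<in>\<kappa> ` Pow Q. c k)"
      by (intro sum_mono inner)
    also have "\<dots> \<le> suminf c"
      using sc fin c_pos by (intro sum_le_suminf) (auto simp: less_imp_le)
    finally show "(\<Sum>S\<in>Pow Q. (\<Prod>p\<in>S. 1 / (real p - 1)) * real (ord (\<Prod>S) a) powr (- \<delta>)) \<le> suminf c"
      by (simp add: w_def \<theta>_def)
  qed
qed

section \<open>Polynomial congruences\<close>

text \<open>
  Splitting off one zero modulo \<open>t\<close> by synthetic division costs a factor at most \<open>L ^ n\<close> in the leading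
  coefficient and lowers the degree by one.
\<close>

lemma dvd_poly_values_bound:
  fixes F :: "int poly" and t L :: int
  assumes "degree F = n" "F \<noteq> 0" "finite S" "card S = Suc n"
    "\<And>x. x \<in> S \<Longrightarrow> t dvd poly F x" "\<And>x y. x \<in> S \<Longrightarrow> y \<in> S \<Longrightarrow> \<bar>x - y\<bar> \<le> L"
  shows "\<bar>t\<bar> \<le> \<bar>lead_coeff F\<bar> * L ^ (\<Sum>i\<le>n. i)"
  using assms
proof (induction n arbitrary: F S)
  case 0
  then obtain x where "x \<in> S" by fastforce
  with 0 have "t dvd poly F x" by blast
  moreover have "poly F x = lead_coeff F"
    using 0 by (cases F) (auto split: if_splits)
  ultimately show ?case
    using 0 leading_coeff_0_iff[of F] dvd_imp_le_int[of "lead_coeff F" t] by simp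
next
  case (Suc n)
  then obtain x0 where x0: "x0 \<in> S" by fastforce
  define G where "G = synthetic_div F x0"
  \<comment> \<open>A difference x - x0 may share factors with \<open>t\<close> and cannot be
    cancelled. Multiplying the quotient \<open>G\<close> by all the differences at once gives a
    single polynomial that vanishes modulo \<open>t\<close> at every remaining point.\<close>
  define Q where "Q = (\<Prod>x\<in>S - {x0}. x - x0)"
  have F: "F = [:- x0, 1:] * G + [:poly F x0:]"
    unfolding G_def by (rule synthetic_div_correct'[symmetric])
  have G: "degree G = n" "G \<noteq> 0"
    using Suc.prems by (simp_all add: G_def degree_synthetic_div synthetic_div_eq_0_iff)
  have "lead_coeff F = Polynomial.coeff ([:- x0, 1:] * G + [:poly F x0:]) (Suc n)"
    using F Suc.prems(1) by simp
  also have "\<dots> = lead_coeff G"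
    using G coeff_eq_0[of G "Suc n"] by simp
  finally have lc: "lead_coeff F = lead_coeff G" .
  have Q0: "Q \<noteq> 0"
    unfolding Q_def using Suc.prems(3) by simp
  have "\<bar>t\<bar> \<le> \<bar>lead_coeff (Polynomial.smult Q G)\<bar> * L ^ (\<Sum>i\<le>n. i)"
  proof (rule Suc.IH[where S = "S - {x0}"])
    fix x assume x: "x \<in> S - {x0}"
    have "(x - x0) * poly G x = poly F x - poly F x0"
      by (subst F) (simp add: algebra_simps)
    then have "t dvd (x - x0) * poly G x"
      using Suc.prems(5) x x0 by simp
    moreover have "(x - x0) dvd Q"
      unfolding Q_def using Suc.prems(3) x by (intro dvd_prodI) auto
    then have "(x - x0) * poly G x dvd Q * poly G x" by (rule mult_dvd_mono) simp
    ultimately show "t dvd poly (Polynomial.smult Q G) x" by (auto intro: dvd_trans)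
  qed (use Suc.prems G Q0 x0 in auto)
  also have "\<dots> = \<bar>lead_coeff F\<bar> * (\<bar>Q\<bar> * L ^ (\<Sum>i\<le>n. i))"
    by (simp add: lc abs_mult lead_coeff_smult)
  also have "\<dots> \<le> \<bar>lead_coeff F\<bar> * (L ^ Suc n * L ^ (\<Sum>i\<le>n. i))"
  proof (intro mult_left_mono mult_right_mono)
    have "\<bar>Q\<bar> \<le> (\<Prod>x\<in>S - {x0}. L)"
      unfolding Q_def abs_prod using Suc.prems(6) x0 by (intro prod_mono) auto
    then show "\<bar>Q\<bar> \<le> L ^ Suc n"
      using Suc.prems(3,4) x0 by simp
    show "0 \<le> L ^ (\<Sum>i\<le>n. i)"
      using Suc.prems(6)[OF x0 x0] by simp
  qed simp
  also have "L ^ Suc n * L ^ (\<Sum>i\<le>n. i) = L ^ (\<Sum>i\<le>Suc n. i)"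
    by (simp flip: power_add add: add.commute)
  finally show ?case .
qed

text \<open>Cut the range into blocks of L + 1 consecutive integers. A block with more than
  \<open>degree F\<close> zeros modulo \<open>t\<close> would contradict
  \<open>dvd_poly_values_bound\<close>, as its points differ by at most \<open>L\<close>.\<close>

lemma card_poly_dvd_le_blocks:
  fixes F :: "int poly" and t :: int and L N :: nat
  assumes "F \<noteq> 0" "\<bar>lead_coeff F\<bar> * int L ^ (\<Sum>i\<le>degree F. i) < \<bar>t\<bar>"
  shows "card {m \<in> {1..N}. t dvd poly F (int m)} \<le> degree F * (N div Suc L + 1)"
proof -
  let ?T = "{m \<in> {1..N}. t dvd poly F (int m)}"
  let ?B = "\<lambda>q. {m \<in> ?T. m div Suc L = q}"
  have block: "card (?B q) \<le> degree F" for q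
  proof (rule ccontr)
    assume "\<not> card (?B q) \<le> degree F"
    then have "Suc (degree F) \<le> card (?B q)" by simp
    then obtain S where S: "S \<subseteq> ?B q" "card S = Suc (degree F)" "finite S"
      by (rule obtain_subset_with_card_n)
    have diam: "\<bar>int m - int m'\<bar> \<le> int L" if "m \<in> S" "m' \<in> S" for m m'
    proof -
      have "m div Suc L = m' div Suc L" using that S(1) by auto
      then have "int m - int m' = int (m mod Suc L) - int (m' mod Suc L)"
        by (metis add_diff_cancel_left div_mult_mod_eq of_nat_add)
      moreover have "m mod Suc L \<le> L" "m' mod Suc L \<le> L"
        by (simp_all add: less_Suc_eq_le[symmetric])
      ultimately show ?thesis by linarith
    qed
    have "\<bar>t\<bar> \<le> \<bar>lead_coeff F\<bar> * int L ^ (\<Sum>i\<le>degree F. i)"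
      using assms(1) S diam
      by (intro dvd_poly_values_bound[where S = "int ` S"]) (auto simp: card_image)
    with assms(2) show False by simp
  qed
  have "?T = (\<Union>q\<in>{..N div Suc L}. ?B q)"
    by (auto intro: div_le_mono)
  then have "card ?T \<le> (\<Sum>q\<le>N div Suc L. card (?B q))"
    using card_UN_le[of "{..N div Suc L}" ?B] by (simp only: finite_atMost)
  also have "\<dots> \<le> (\<Sum>q\<le>N div Suc L. degree F)"
    by (intro sum_mono block)
  finally show ?thesis by (simp add: mult.commute)
qed

text \<open>Blocks of length about s = (t/g)^\<delta>, with g the absolute leading coefficient, are
  the longest that the block bound admits. The summand 1 pays for an incomplete block. For s \<le> 1
  the trivial bound N \<le> N/s suffices.\<close>

lemma card_poly_dvd_le_powr:
  fixes F :: "int poly" and t N :: nat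
  assumes "degree F = d" "d \<ge> 1" "t \<ge> 1"
  defines "\<delta> \<equiv> 1 / real (\<Sum>i\<le>d. i)"
  shows "real (card {m \<in> {1..N}. int t dvd poly F (int m)})
    \<le> real d * (\<bar>real_of_int (lead_coeff F)\<bar> powr \<delta> * (real N * real t powr (- \<delta>)) + 1)"
proof -
  define D where "D = (\<Sum>i\<le>d. i)"
  define g where "g = \<bar>real_of_int (lead_coeff F)\<bar>"
  define s where "s = (real t / g) powr \<delta>"
  have F0: "F \<noteq> 0" using assms by auto
  then have g: "g \<ge> 1" by (simp add: g_def) (metis abs_ge_zero leading_coeff_0_iff linorder_not_le nle_le zero_less_abs_iff int_one_le_iff_zero_less of_int_1_le_iff of_int_abs)
  have D: "D \<ge> 1" using assms(2) member_le_sum[of d "{..d}" "\<lambda>i. i"] by (simp add: D_def)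
  have \<delta>: "\<delta> > 0" "\<delta> * real D = 1" using D unfolding \<delta>_def D_def[symmetric] by simp_all
  have s0: "s > 0" using g assms by (simp add: s_def)
  have main: "g powr \<delta> * (real N * real t powr (- \<delta>)) = real N / s"
    using g assms by (simp add: s_def powr_divide powr_minus field_simps)
  show ?thesis
  proof (cases "s \<le> 1")
    case True
    have "card {m \<in> {1..N}. int t dvd poly F (int m)} \<le> card {1..N}"
      by (rule card_mono) auto
    then have "real (card {m \<in> {1..N}. int t dvd poly F (int m)}) \<le> real N" by simp
    also have "\<dots> \<le> real N / s" using True s0 mult_right_mono[of s 1 "real N"] by (simp add: field_simps)
    also have "\<dots> \<le> real d * (real N / s + 1)"
      using assms(2) s0 mult_right_mono[of 1 "real d" "real N / s + 1"] by simp
    finally show ?thesis using main by (simp add: g_def)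
  next
    case False
    \<comment> \<open>The largest integer strictly below \<open>s\<close>: strictness gives g L^D <
      t, while L + 1 \<ge> s keeps the number of blocks at most N/s + 1.\<close>
    define L where "L = nat \<lceil>s\<rceil> - 1"
    have L: "real L < s" "s \<le> real (Suc L)"
      using False by (simp_all add: L_def) linarith+
    have "real L ^ D < s ^ D"
      using L D by (intro power_strict_mono) auto
    also have "s ^ D = real t / g"
      using \<delta> s0 g assms by (simp add: s_def powr_powr flip: powr_realpow)
    finally have "g * real L ^ D < real t" using g by (simp add: field_simps)
    then have "real_of_int (\<bar>lead_coeff F\<bar> * int L ^ (\<Sum>i\<le>degree F. i)) < real_of_int \<bar>int t\<bar>"
      by (simp add: g_def D_def assms(1))
    then have "\<bar>lead_coeff F\<bar> * int L ^ (\<Sum>i\<le>degree F. i) < \<bar>int t\<bar>"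
      by (simp only: of_int_less_iff)
    then have "card {m \<in> {1..N}. int t dvd poly F (int m)} \<le> d * (N div Suc L + 1)"
      using card_poly_dvd_le_blocks[OF F0] assms(1) by blast
    then have "real (card {m \<in> {1..N}. int t dvd poly F (int m)}) \<le> real d * (real (N div Suc L) + 1)"
      by (metis of_nat_1 of_nat_add of_nat_le_iff of_nat_mult)
    also have "\<dots> \<le> real d * (real N / s + 1)"
    proof -
      have "real (N div Suc L) \<le> real N / real (Suc L)" by (rule of_nat_div_le_of_nat)
      also have "\<dots> \<le> real N / s" using L s0 by (intro divide_left_mono) auto
      finally show ?thesis by (intro mult_left_mono) auto
    qed
    finally show ?thesis using main by (simp add: g_def)
  qed
qed

text \<open>For t \<le> B N^d the summand 1 is absorbed: d \<delta> \<le> 1 gives t^\<delta> \<le> B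
  N. Uniformity in \<open>c\<close> holds because subtracting a constant leaves the degree and the
  leading coefficient unchanged.\<close>

lemma card_poly_cong_le:
  fixes f :: "int poly" and B :: nat
  assumes "degree f = d" "d \<ge> 1" "B \<ge> 1"
  defines "\<delta> \<equiv> 1 / real (\<Sum>i\<le>d. i)"
  shows "\<exists>C>0. \<forall>N\<ge>1. \<forall>t\<ge>1. \<forall>c. t \<le> B * N ^ d \<longrightarrow>
    real (card {m \<in> {1..N}. int t dvd poly f (int m) - c}) \<le> C * (real N * real t powr (- \<delta>))"
proof -
  define g where "g = \<bar>real_of_int (lead_coeff f)\<bar>"
  define C where "C = real d * (g powr \<delta> + real B)"
  define D where "D = (\<Sum>i\<le>d. i)"
  have "d \<le> D" using member_le_sum[of d "{..d}" "\<lambda>i. i"] by (simp add: D_def)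
  then have \<delta>: "\<delta> > 0" "real d * \<delta> \<le> 1" "\<delta> \<le> 1"
    using assms(2) unfolding \<delta>_def D_def[symmetric] by simp_all
  show ?thesis
  proof (intro exI[of _ C] conjI allI impI)
    show "C > 0" using assms by (simp add: C_def add_nonneg_pos)
  next
    fix N t :: nat and c :: int
    assume N: "N \<ge> 1" and t: "t \<ge> 1" "t \<le> B * N ^ d"
    define F where "F = f + [:- c:]"
    have F: "degree F = d" "lead_coeff F = lead_coeff f"
      using assms(1,2) by (simp_all add: F_def degree_add_eq_left coeff_pCons split: nat.split)
    have "real t powr \<delta> \<le> (real B * real N ^ d) powr \<delta>"
      using t \<delta> by (intro powr_mono2) (auto simp flip: of_nat_mult of_nat_power)
    also have "\<dots> = real B powr \<delta> * real N powr (real d * \<delta>)"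
      using N assms(3) by (simp add: powr_mult powr_powr flip: powr_realpow)
    also have "\<dots> \<le> real B powr 1 * real N powr 1"
      using N assms(3) \<delta> by (intro mult_mono powr_mono) auto
    finally have "1 \<le> real B * (real N * real t powr (- \<delta>))"
      using N t assms(3) by (simp add: powr_minus field_simps)
    then have "real d * (g powr \<delta> * (real N * real t powr (- \<delta>)) + 1)
        \<le> real d * (g powr \<delta> * (real N * real t powr (- \<delta>)) + real B * (real N * real t powr (- \<delta>)))"
      by (intro mult_left_mono add_left_mono) auto
    also have "\<dots> = C * (real N * real t powr (- \<delta>))"
      by (simp add: C_def algebra_simps)
    finally have "real d * (g powr \<delta> * (real N * real t powr (- \<delta>)) + 1) \<le> C * (real N * real t powr (- \<delta>))" .
    then show "real (card {m \<in> {1..N}. int t dvd poly f (int m) - c}) \<le> C * (real N * real t powr (- \<delta>))"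
    proof -
      have "poly F (int m) = poly f (int m) - c" for m by (simp add: F_def)
      then show ?thesis
        using card_poly_dvd_le_powr[OF F(1) assms(2) t(1), of N]
          \<open>real d * (g powr \<delta> * (real N * real t powr (- \<delta>)) + 1) \<le> C * (real N * real t powr (- \<delta>))\<close>
        unfolding F(2) g_def[symmetric] \<delta>_def[symmetric] by simp
    qed
  qed
qed

section \<open>Growth and multiplicity of polynomial values\<close>

lemma poly_le_power:
  fixes f :: "int poly"
  shows "\<exists>B::nat. B \<ge> 1 \<and> (\<forall>m::nat. m \<ge> 1 \<longrightarrow> poly f (int m) \<le> int (B * m ^ degree f))"
proof -
  define S where "S = (\<Sum>i\<le>degree f. \<bar>Polynomial.coeff f i\<bar>)"
  have S: "S \<ge> 0" by (simp add: S_def sum_nonneg)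
  have "poly f (int m) \<le> int ((nat S + 1) * m ^ degree f)" if "m \<ge> 1" for m
  proof -
    have "poly f (int m) \<le> (\<Sum>i\<le>degree f. \<bar>Polynomial.coeff f i\<bar> * int m ^ degree f)"
      unfolding poly_altdef
      using that by (intro sum_mono mult_mono) (auto intro: power_increasing)
    also have "\<dots> = S * int m ^ degree f" by (simp add: S_def sum_distrib_right)
    also have "\<dots> \<le> (S + 1) * int m ^ degree f" by (intro mult_right_mono) auto
    finally show ?thesis using S by (simp add: algebra_simps)
  qed
  then show ?thesis by (intro exI[of _ "nat S + 1"]) auto
qed

lemma
  fixes f :: "int poly"
  assumes "degree f = d" "d \<ge> 1"
  shows finite_poly_eq: "finite {m :: nat. poly f (int m) = c}"
    and card_poly_eq_le: "card {m :: nat. poly f (int m) = c} \<le> d"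
proof -
  define F where "F = f + [:- c:]"
  have F: "degree F = d"
    using assms by (auto simp: F_def degree_add_eq_left)
  then have F0: "F \<noteq> 0" using assms(2) by auto
  have sub: "int ` {m. poly f (int m) = c} \<subseteq> {x. poly F x = 0}"
    by (auto simp: F_def)
  have fin: "finite {x. poly F x = 0}" using F0 by (rule poly_roots_finite)
  show "finite {m :: nat. poly f (int m) = c}"
    using finite_subset[OF sub fin] by (simp add: finite_image_iff)
  have "card {m :: nat. poly f (int m) = c} = card (int ` {m. poly f (int m) = c})"
    by (simp add: card_image)
  also have "\<dots> \<le> card {x. poly F x = 0}" by (rule card_mono[OF fin sub])
  also have "\<dots> \<le> d" using card_poly_roots_bound[OF F0] F by simp
  finally show "card {m :: nat. poly f (int m) = c} \<le> d" .
qed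

section \<open>Counting representations\<close>

text \<open>The average of n/phi(n) over the shifts is bounded. After expansion, each
  \<open>S\<close> counts pairs with f(m') = f(m) modulo the order of \<open>a\<close>; these are
  O(N^2) times the order to the power -\<delta>, and \<open>ord_weighted_sum_bounded\<close> sums
  the result.\<close>

lemma sum_over_totient_power_diff_le:
  fixes a d :: nat and f :: "int poly" and v :: "nat \<Rightarrow> nat"
  assumes a: "a \<ge> 2" and f: "degree f = d" "d \<ge> 1"
    and pos: "\<And>m::nat. m \<ge> 1 \<Longrightarrow> poly f (int m) \<ge> 1"
  defines "v \<equiv> \<lambda>m. nat (poly f (int m))"
  shows "\<exists>C>0. \<forall>N\<ge>1. (\<Sum>(m, m') | m \<in> {1..N} \<and> m' \<in> {1..N} \<and> v m < v m'.
    real (a ^ v m' - a ^ v m) / real (totient (a ^ v m' - a ^ v m))) \<le> C * real N ^ 2"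
proof -
  define \<delta> where "\<delta> = 1 / real (\<Sum>i\<le>d. i)"
  have "1 \<le> (\<Sum>i\<le>d. i)" using f(2) member_le_sum[of d "{..d}" "\<lambda>i. i"] by simp
  then have \<delta>: "\<delta> > 0" unfolding \<delta>_def by (simp del: of_nat_sum)
  obtain B where B: "B \<ge> 1" "\<And>m::nat. m \<ge> 1 \<Longrightarrow> poly f (int m) \<le> int (B * m ^ d)"
    using poly_le_power[of f] f(1) by blast
  obtain C1 where C1: "C1 > 0"
    "\<And>N t c. N \<ge> 1 \<Longrightarrow> t \<ge> 1 \<Longrightarrow> t \<le> B * N ^ d \<Longrightarrow>
      real (card {m \<in> {1..N}. int t dvd poly f (int m) - c}) \<le> C1 * (real N * real t powr (- \<delta>))"
    using card_poly_cong_le[OF f B(1)] unfolding \<delta>_def by blast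
  obtain C2 where C2: "C2 > 0"
    "\<And>Q. finite Q \<Longrightarrow> (\<forall>p\<in>Q. prime p \<and> coprime p a) \<Longrightarrow>
      (\<Sum>S\<in>Pow Q. (\<Prod>p\<in>S. 1 / (real p - 1)) * real (ord (\<Prod>S) a) powr (- \<delta>)) \<le> C2"
    using ord_weighted_sum_bounded[OF a \<delta>] by blast
  define E where "E = euler_prod (prime_factors a)"
  have E: "E \<ge> 1"
    unfolding E_def by (rule euler_prod_ge_1) (auto intro: prime_ge_2_nat)
  have vint: "int (v m) = poly f (int m)" "v m \<ge> 1" if "m \<ge> 1" for m
    using pos[OF that] by (simp_all add: v_def)
  show ?thesis
  proof (intro exI[of _ "E * (C1 * C2)"] conjI allI impI)
    show "E * (C1 * C2) > 0" using E C1(1) C2(1) by simp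
  next
    fix N :: nat
    assume N: "N \<ge> 1"
    define T where "T = {(m, m'). m \<in> {1..N} \<and> m' \<in> {1..N} \<and> v m < v m'}"
    have finT: "finite T"
      by (rule finite_subset[of _ "{1..N} \<times> {1..N}"]) (auto simp: T_def)
    \<comment> \<open>One finite set of primes for all pairs, so that the sums over pairs and over
      subsets can be exchanged.\<close>
    define Q where "Q = (\<Union>(m, m')\<in>T. prime_factors (a ^ (v m' - v m) - 1))"
    have finQ: "finite Q" unfolding Q_def using finT by auto
    have Qprime: "prime p \<and> coprime p a" if "p \<in> Q" for p
    proof -
      from that obtain m m' where T: "(m, m') \<in> T" and "p \<in> prime_factors (a ^ (v m' - v m) - 1)"
        by (auto simp: Q_def)
      then have p: "prime p" "p dvd a ^ (v m' - v m) - 1" by auto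
      have j: "v m' - v m \<noteq> 0" using T by (auto simp: T_def)
      have "\<not> p dvd a"
      proof
        assume "p dvd a"
        then have "p dvd a ^ (v m' - v m)" using j by (auto intro: dvd_trans dvd_power)
        then have "p dvd a ^ (v m' - v m) - (a ^ (v m' - v m) - 1)" using p(2) by (rule dvd_diff_nat)
        moreover have "a ^ (v m' - v m) - (a ^ (v m' - v m) - 1) = 1"
          using a by (simp add: Suc_leI)
        ultimately have "p dvd 1" by (simp only:)
        with p(1) show False by simp
      qed
      with p(1) show ?thesis by (simp add: prime_imp_coprime)
    qed
    define w where "w = (\<lambda>S::nat set. \<Prod>p\<in>S. 1 / (real p - 1))"
    define \<theta> where "\<theta> = (\<lambda>S. ord (\<Prod>S) a)"
    have w0: "w S \<ge> 0" if "S \<subseteq> Q" for S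
      unfolding w_def
    proof (rule prod_nonneg)
      fix p assume "p \<in> S"
      then have "p \<ge> 1" using that Qprime prime_ge_1_nat[of p] by blast
      then show "0 \<le> 1 / (real p - 1)" by simp
    qed
    have \<theta>1: "\<theta> S \<ge> 1" if "S \<subseteq> Q" for S
    proof -
      have "coprime (\<Prod>S) a"
        using that Qprime by (intro prod_coprime_left) auto
      then show ?thesis by (simp add: \<theta>_def Suc_le_eq)
    qed
    define c where "c = (\<lambda>S. real (card {(m, m') \<in> T. \<theta> S dvd v m' - v m}))"
    have ratio: "real (a ^ v m' - a ^ v m) / real (totient (a ^ v m' - a ^ v m))
        = E * (\<Sum>S\<in>Pow Q. if \<theta> S dvd v m' - v m then w S else 0)" if "(m, m') \<in> T" for m m'
    proof -
      have m: "m \<ge> 1" "m' \<ge> 1" "v m < v m'" using that by (auto simp: T_def)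
      have "prime_factors (a ^ (v m' - v m) - 1) \<subseteq> Q" using that by (auto simp: Q_def)
      then have "euler_prod (prime_factors (a ^ (v m' - v m) - 1))
          = (\<Sum>S\<in>Pow Q. if \<theta> S dvd v m' - v m then w S else 0)"
        unfolding \<theta>_def w_def using m a finQ Qprime
        by (intro euler_prod_prime_factors_eq_sum) auto
      then show ?thesis
        using over_totient_power_diff[of a "v m" "v m' - v m"] a m vint(2)[OF m(1)]
        by (simp add: E_def)
    qed
    have count: "c S \<le> C1 * real N ^ 2 * real (\<theta> S) powr (- \<delta>)" if S: "S \<subseteq> Q" for S
    proof (cases "{(m, m') \<in> T. \<theta> S dvd v m' - v m} = {}")
      case True
      then have "c S = 0" unfolding c_def by (simp only: card.empty of_nat_0)
      then show ?thesis using C1(1) by simp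
    next
      case False
      \<comment> \<open>A single counted pair already forces \<theta> S \<le> B N^d, the range in
        which the congruence bound applies.\<close>
      then obtain m0 m0' where m0: "(m0, m0') \<in> T" "\<theta> S dvd v m0' - v m0" by auto
      then have "\<theta> S \<le> v m0' - v m0" by (intro dvd_imp_le) (auto simp: T_def)
      also have "\<dots> \<le> v m0'" by simp
      also have "v m0' \<le> B * m0' ^ d"
      proof -
        have "m0' \<ge> 1" using m0(1) by (simp add: T_def)
        then have "int (v m0') \<le> int (B * m0' ^ d)" using B(2) vint(1) by metis
        then show ?thesis by (simp only: of_nat_le_iff)
      qed
      also have "\<dots> \<le> B * N ^ d"
        using m0(1) by (intro mult_left_mono power_mono) (auto simp: T_def)
      finally have \<theta>N: "\<theta> S \<le> B * N ^ d" .
      \<comment> \<open>For each fixed \<open>m\<close> the admissible \<open>m'\<close> solve one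
        congruence, with c = f(m).\<close>
      have sub: "{(m, m') \<in> T. \<theta> S dvd v m' - v m} \<subseteq>
        Sigma {1..N} (\<lambda>m. {m' \<in> {1..N}. int (\<theta> S) dvd poly f (int m') - poly f (int m)})"
      proof safe
        fix m m' assume T: "(m, m') \<in> T" and dvd: "\<theta> S dvd v m' - v m"
        then have "int (\<theta> S) dvd int (v m' - v m)" by (simp only: int_dvd_int_iff)
        moreover have "int (v m' - v m) = poly f (int m') - poly f (int m)"
          using T by (auto simp: T_def of_nat_diff vint(1))
        ultimately show "int (\<theta> S) dvd poly f (int m') - poly f (int m)" by simp
      qed (auto simp: T_def)
      have "card {(m, m') \<in> T. \<theta> S dvd v m' - v m} \<le>
        card (Sigma {1..N} (\<lambda>m. {m' \<in> {1..N}. int (\<theta> S) dvd poly f (int m') - poly f (int m)}))"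
        by (rule card_mono[OF _ sub]) auto
      then have "c S \<le> (\<Sum>m\<in>{1..N}. real (card {m' \<in> {1..N}. int (\<theta> S) dvd poly f (int m') - poly f (int m)}))"
        unfolding c_def by (simp add: card_SigmaI flip: of_nat_sum)
      also have "\<dots> \<le> (\<Sum>m\<in>{1..N}. C1 * (real N * real (\<theta> S) powr (- \<delta>)))"
        by (intro sum_mono C1(2) N \<theta>1 S \<theta>N)
      finally show ?thesis by (simp add: power2_eq_square algebra_simps)
    qed
    have "(\<Sum>(m, m')\<in>T. real (a ^ v m' - a ^ v m) / real (totient (a ^ v m' - a ^ v m)))
        = (\<Sum>(m, m')\<in>T. E * (\<Sum>S\<in>Pow Q. if \<theta> S dvd v m' - v m then w S else 0))"
      by (rule sum.cong) (use ratio in auto)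
    also have "\<dots> = E * (\<Sum>S\<in>Pow Q. \<Sum>(m, m')\<in>T. if \<theta> S dvd v m' - v m then w S else 0)"
      by (subst sum.swap) (simp add: sum_distrib_left case_prod_unfold)
    also have "(\<Sum>S\<in>Pow Q. \<Sum>(m, m')\<in>T. if \<theta> S dvd v m' - v m then w S else 0)
        = (\<Sum>S\<in>Pow Q. w S * c S)"
      unfolding c_def case_prod_unfold using finT by (simp add: sum.If_cases Int_def mult.commute)
    also have "\<dots> \<le> (\<Sum>S\<in>Pow Q. w S * (C1 * real N ^ 2 * real (\<theta> S) powr (- \<delta>)))"
      by (intro sum_mono mult_left_mono count w0) auto
    also have "\<dots> = C1 * real N ^ 2 * (\<Sum>S\<in>Pow Q. w S * real (\<theta> S) powr (- \<delta>))"
      by (simp add: sum_distrib_left algebra_simps)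
    also have "\<dots> \<le> C1 * real N ^ 2 * C2"
      using C2(2)[OF finQ] Qprime C1(1) unfolding w_def \<theta>_def by (intro mult_left_mono) auto
    finally show "(\<Sum>(m, m') | m \<in> {1..N} \<and> m' \<in> {1..N} \<and> v m < v m'.
      real (a ^ v m' - a ^ v m) / real (totient (a ^ v m' - a ^ v m))) \<le> E * (C1 * C2) * real N ^ 2"
      unfolding T_def using E by (simp add: algebra_simps)
  qed
qed

text \<open>The second moment method. Fibres smaller than M/(2x) cover at most M/2 elements, as
  there are at most \<open>x\<close> values. At least M/2 elements remain, and since the squared
  fibre sizes sum to at most \<open>V\<close>, Cauchy-Schwarz spreads them over at least M^2/(4V)
  values.\<close>

lemma card_large_fibres_ge:
  fixes g :: "'a \<Rightarrow> nat" and x M V :: real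
  assumes fin: "finite X" and g: "\<And>u. u \<in> X \<Longrightarrow> g u \<ge> 1 \<and> real (g u) \<le> x"
    and x: "x > 0" and M: "0 < M" "M \<le> real (card X)"
    and V: "real (card {(u, u'). u \<in> X \<and> u' \<in> X \<and> g u = g u'}) \<le> V" "V > 0"
  shows "M\<^sup>2 / (4 * V)
    \<le> real (card {n. n \<ge> 1 \<and> real n \<le> x \<and> M / (2 * x) \<le> real (card {u \<in> X. g u = n})})"
proof -
  define I where "I = {n::nat. n \<ge> 1 \<and> real n \<le> x}"
  define r where "r = (\<lambda>n. real (card {u \<in> X. g u = n}))"
  define G where "G = {n \<in> I. M / (2 * x) \<le> r n}"
  \<comment> \<open>Cauchy-Schwarz in the form \<open>r \<le> r\<^sup>2 / (2 * s) + s / 2\<close>; this \<open>s\<close> balances the two terms.\<close>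
  define s where "s = 2 * V / M"
  have s: "s > 0" using M V by (simp add: s_def)
  have "n \<in> I \<longleftrightarrow> n \<in> {1..nat \<lfloor>x\<rfloor>}" for n
    using x by (auto simp: I_def le_nat_floor le_nat_iff le_floor_iff)
  then have I: "I = {1..nat \<lfloor>x\<rfloor>}" by blast
  have finI: "finite I" and cardI: "real (card I) \<le> x"
    using x by (auto simp: I)
  have sum1: "(\<Sum>n\<in>I. r n) = real (card X)"
  proof -
    have "g ` X \<subseteq> I" using g by (auto simp: I_def)
    then have "card X = (\<Sum>n\<in>I. card {u \<in> X. g u = n})"
      using sum.group[OF fin finI, of g "\<lambda>_. 1 :: nat"] by simp
    then show ?thesis by (simp add: r_def)
  qed
  have sum2: "(\<Sum>n\<in>I. (r n)\<^sup>2) \<le> V"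
  proof -
    have "{(u, u'). u \<in> X \<and> u' \<in> X \<and> g u = g u'} = (\<Union>n\<in>I. {u \<in> X. g u = n} \<times> {u \<in> X. g u = n})"
      using g by (auto simp: I_def)
    also have "card \<dots> = (\<Sum>n\<in>I. card ({u \<in> X. g u = n} \<times> {u \<in> X. g u = n}))"
      using finI fin by (intro card_UN_disjoint) auto
    finally have "real (card {(u, u'). u \<in> X \<and> u' \<in> X \<and> g u = g u'}) = (\<Sum>n\<in>I. (r n)\<^sup>2)"
      by (simp add: r_def card_cartesian_product power2_eq_square)
    then show ?thesis using V(1) by simp
  qed
  have "r n \<le> M / (2 * x) + (r n)\<^sup>2 / (2 * s) + (if n \<in> G then s / 2 else 0)" if "n \<in> I" for n
  proof (cases "n \<in> G")
    case True
    have "0 \<le> (r n - s)\<^sup>2 / (2 * s)" using s by simp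
    also have "\<dots> = (r n)\<^sup>2 / (2 * s) + s / 2 - r n"
      using s by (simp add: power2_eq_square field_simps)
    finally have "r n \<le> (r n)\<^sup>2 / (2 * s) + s / 2" by simp
    moreover have "M / (2 * x) \<ge> 0" using M x by simp
    ultimately show ?thesis using True by simp
  next
    case False
    then have "r n \<le> M / (2 * x)" using that by (simp add: G_def)
    moreover have "(r n)\<^sup>2 / (2 * s) \<ge> 0" using s by simp
    ultimately show ?thesis using False by simp
  qed
  then have "(\<Sum>n\<in>I. r n) \<le> (\<Sum>n\<in>I. M / (2 * x) + (r n)\<^sup>2 / (2 * s) + (if n \<in> G then s / 2 else 0))"
    by (rule sum_mono)
  also have "\<dots> = real (card I) * (M / (2 * x)) + (\<Sum>n\<in>I. (r n)\<^sup>2) / (2 * s) + (\<Sum>n\<in>I. if n \<in> G then s / 2 else 0)"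
    by (simp add: sum.distrib sum_divide_distrib)
  also have "(\<Sum>n\<in>I. if n \<in> G then s / 2 else 0) = real (card G) * (s / 2)"
    using finI by (simp add: sum.If_cases G_def Int_def)
  also have "real (card I) * (M / (2 * x)) \<le> x * (M / (2 * x))"
    using cardI M x by (intro mult_right_mono) auto
  also have "x * (M / (2 * x)) = M / 2" using x by simp
  also have "(\<Sum>n\<in>I. (r n)\<^sup>2) / (2 * s) \<le> V / (2 * s)"
    using sum2 s by (intro divide_right_mono) auto
  also have "V / (2 * s) = M / 4" using V M by (simp add: s_def)
  finally have "M \<le> M / 2 + M / 4 + real (card G) * (s / 2)"
    using sum1 M by simp
  then have "M / 4 \<le> real (card G) * (s / 2)" by linarith
  also have "s / 2 = V / M" by (simp add: s_def)
  finally have "M / 4 \<le> real (card G) * (V / M)" .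
  then have "M\<^sup>2 / (4 * V) \<le> real (card G)"
    using M V by (simp add: field_simps power2_eq_square)
  then show ?thesis by (simp add: G_def I_def r_def conj_assoc)
qed

section \<open>The sequence and the coincidences among the sums\<close>

lemma
  assumes "pos_strict_seq A"
  shows pos_strict_seq_inj_on: "inj_on A {1..}"
    and pos_strict_seq_ge: "k \<ge> 1 \<Longrightarrow> k \<le> A k"
    and pos_strict_seq_finite: "finite {k. k \<ge> 1 \<and> real (A k) \<le> x}"
proof -
  have mono: "strict_mono_on {1..} A" and pos: "\<And>n. n \<ge> 1 \<Longrightarrow> A n > 0"
    using assms by (auto simp: pos_strict_seq_def)
  show "inj_on A {1..}" using mono by (rule strict_mono_on_imp_inj_on)
  have ge: "k \<le> A k" if "k \<ge> 1" for k
    using that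
  proof (induction k rule: dec_induct)
    case base
    then show ?case using pos[of 1] by simp
  next
    case (step k)
    then have "A k < A (Suc k)" using strict_mono_onD[OF mono, of k "Suc k"] by simp
    with step show ?case by simp
  qed
  then show "k \<ge> 1 \<Longrightarrow> k \<le> A k" .
  show "finite {k. k \<ge> 1 \<and> real (A k) \<le> x}"
  proof (rule finite_subset)
    show "{k. k \<ge> 1 \<and> real (A k) \<le> x} \<subseteq> {..nat \<lfloor>x\<rfloor>}"
    proof
      fix k assume "k \<in> {k. k \<ge> 1 \<and> real (A k) \<le> x}"
      then have "real k \<le> x" using ge[of k] by simp
      then show "k \<in> {..nat \<lfloor>x\<rfloor>}" by (simp add: le_nat_floor)
    qed
  qed simp
qed

text \<open>As \<open>A\<close> is injective, \<open>k'\<close> determines \<open>k\<close>, and A k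
  = A k' + (b' - b) is a shifted member of the sequence.\<close>

lemma card_shifted_pairs_le:
  assumes A: "pos_strict_seq A" and b: "b < b'" and y: "y \<le> x"
  shows "card {(k, k'). k \<ge> 1 \<and> real (A k) \<le> y \<and> k' \<ge> 1 \<and> real (A k') \<le> y \<and> A k + b = A k' + b'}
    \<le> seq_shift_count A x (b' - b)"
  unfolding seq_shift_count_def
proof (rule card_inj_on_le[where f = snd])
  show "inj_on snd {(k, k'). k \<ge> 1 \<and> real (A k) \<le> y \<and> k' \<ge> 1 \<and> real (A k') \<le> y \<and> A k + b = A k' + b'}"
    using inj_onD[OF pos_strict_seq_inj_on[OF A]] by (auto simp: inj_on_def)
  show "finite {n. 1 \<le> n \<and> real (A n) \<le> x \<and> A n + (b' - b) \<in> A ` {1..}}"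
    by (rule finite_subset[OF _ pos_strict_seq_finite[OF A, of x]]) auto
  have "A k' + (b' - b) = A k" if "A k + b = A k' + b'" for k k'
    using that b by simp
  then show "snd ` {(k, k'). k \<ge> 1 \<and> real (A k) \<le> y \<and> k' \<ge> 1 \<and> real (A k') \<le> y \<and> A k + b = A k' + b'}
    \<subseteq> {n. 1 \<le> n \<and> real (A n) \<le> x \<and> A n + (b' - b) \<in> A ` {1..}}"
    using y by auto
qed

text \<open>Sort the coincidences by (m, m'). Equal exponents force k = k', which gives the first
  term. Unequal exponents give shifted pairs, and exchanging the two sums accounts for the factor
  2.\<close>

lemma card_equal_sums_le:
  fixes A v :: "nat \<Rightarrow> nat" and a N :: nat
  assumes A: "pos_strict_seq A" and y: "y \<le> x" and a: "a \<ge> 2"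
  defines "X \<equiv> {k. k \<ge> 1 \<and> real (A k) \<le> y} \<times> {1..N}"
    and "g \<equiv> \<lambda>(k, m). A k + a ^ v m"
  shows "card {(u, u'). u \<in> X \<and> u' \<in> X \<and> g u = g u'}
    \<le> seq_count A y * card {(m, m'). m \<in> {1..N} \<and> m' \<in> {1..N} \<and> v m = v m'}
      + 2 * (\<Sum>(m, m') | m \<in> {1..N} \<and> m' \<in> {1..N} \<and> v m < v m'. seq_shift_count A x (a ^ v m' - a ^ v m))"
proof -
  define P where "P = {k. k \<ge> 1 \<and> real (A k) \<le> y}"
  define W where "W = (\<lambda>b b'. {(k, k'). k \<in> P \<and> k' \<in> P \<and> A k + b = A k' + b'})"
  define c where "c = (\<lambda>(m, m'). card (W (a ^ v m) (a ^ v m')))"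
  have finP: "finite P" unfolding P_def by (rule pos_strict_seq_finite[OF A])
  have finW: "finite (W b b')" for b b'
    by (rule finite_subset[of _ "P \<times> P"]) (auto simp: W_def finP)
  let ?E = "{(m, m'). m \<in> {1..N} \<and> m' \<in> {1..N} \<and> v m = v m'}"
  let ?L = "{(m, m'). m \<in> {1..N} \<and> m' \<in> {1..N} \<and> v m < v m'}"
  let ?R = "{(m, m'). m \<in> {1..N} \<and> m' \<in> {1..N} \<and> v m' < v m}"
  have fin: "finite ?E" "finite ?L" "finite ?R"
    by (rule finite_subset[of _ "{1..N} \<times> {1..N}"]; auto)+
  have swapW: "card (W b b') = card (W b' b)" for b b'
    by (rule bij_betw_same_card[of "\<lambda>(k, k'). (k', k)"])
      (rule bij_betwI[where g = "\<lambda>(k, k'). (k', k)"], auto simp: W_def)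
  have "card {(u, u'). u \<in> X \<and> u' \<in> X \<and> g u = g u'}
    = card (Sigma ({1..N} \<times> {1..N}) (\<lambda>(m, m'). W (a ^ v m) (a ^ v m')))"
  proof (rule card_bij_eq)
    show "inj_on (\<lambda>((k, m), (k', m')). ((m, m'), (k, k'))) {(u, u'). u \<in> X \<and> u' \<in> X \<and> g u = g u'}"
      by (rule inj_onI) (simp add: case_prod_unfold prod_eq_iff)
    show "inj_on (\<lambda>((m, m'), (k, k')). ((k, m), (k', m'))) (Sigma ({1..N} \<times> {1..N}) (\<lambda>(m, m'). W (a ^ v m) (a ^ v m')))"
      by (rule inj_onI) (simp add: case_prod_unfold prod_eq_iff)
    show "(\<lambda>((k, m), (k', m')). ((m, m'), (k, k'))) ` {(u, u'). u \<in> X \<and> u' \<in> X \<and> g u = g u'}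
      \<subseteq> Sigma ({1..N} \<times> {1..N}) (\<lambda>(m, m'). W (a ^ v m) (a ^ v m'))"
      by (auto simp: X_def g_def W_def P_def)
    show "(\<lambda>((m, m'), (k, k')). ((k, m), (k', m'))) ` (Sigma ({1..N} \<times> {1..N}) (\<lambda>(m, m'). W (a ^ v m) (a ^ v m')))
      \<subseteq> {(u, u'). u \<in> X \<and> u' \<in> X \<and> g u = g u'}"
      by (auto simp: X_def g_def W_def P_def)
    show "finite {(u, u'). u \<in> X \<and> u' \<in> X \<and> g u = g u'}"
      by (rule finite_subset[of _ "X \<times> X"]) (use finP in \<open>auto simp: X_def P_def\<close>)
    show "finite (Sigma ({1..N} \<times> {1..N}) (\<lambda>(m, m'). W (a ^ v m) (a ^ v m')))"
      using finW by auto
  qed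
  also have "\<dots> = (\<Sum>u\<in>{1..N} \<times> {1..N}. c u)"
    using finW by (subst card_SigmaI) (auto simp: c_def case_prod_unfold)
  also have "{1..N} \<times> {1..N} = ?E \<union> (?L \<union> ?R)" by auto
  also have "sum c (?E \<union> (?L \<union> ?R)) = sum c ?E + (sum c ?L + sum c ?R)"
    using fin by (subst sum.union_disjoint; (subst sum.union_disjoint)?; auto)
  finally have total: "card {(u, u'). u \<in> X \<and> u' \<in> X \<and> g u = g u'} = sum c ?E + (sum c ?L + sum c ?R)" .
  have R: "sum c ?R = sum c ?L"
    by (rule sum.reindex_bij_witness[where i = "\<lambda>(m, m'). (m', m)" and j = "\<lambda>(m, m'). (m', m)"])
      (auto simp: c_def swapW)
  have E: "sum c ?E \<le> (\<Sum>u\<in>?E. seq_count A y)"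
  proof (rule sum_mono)
    fix u assume "u \<in> ?E"
    then obtain m m' where u: "u = (m, m')" "v m = v m'" by auto
    have "card (W (a ^ v m) (a ^ v m')) \<le> card P"
      using inj_onD[OF pos_strict_seq_inj_on[OF A]] u(2)
      by (intro card_inj_on_le[where f = fst] finP) (auto simp: W_def inj_on_def P_def)
    then show "c u \<le> seq_count A y" by (simp add: u(1) c_def P_def seq_count_def)
  qed
  have L: "sum c ?L \<le> (\<Sum>(m, m') | m \<in> {1..N} \<and> m' \<in> {1..N} \<and> v m < v m'. seq_shift_count A x (a ^ v m' - a ^ v m))"
  proof (rule sum_mono)
    fix u assume "u \<in> ?L"
    then obtain m m' where u: "u = (m, m')" "v m < v m'" by auto
    then have "a ^ v m < a ^ v m'" using a by simp
    then show "c u \<le> (case u of (m, m') \<Rightarrow> seq_shift_count A x (a ^ v m' - a ^ v m))"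
      using card_shifted_pairs_le[OF A _ y, of "a ^ v m" "a ^ v m'"]
      by (simp add: u(1) c_def W_def P_def conj_assoc)
  qed
  have "card {(u, u'). u \<in> X \<and> u' \<in> X \<and> g u = g u'}
    \<le> (\<Sum>u\<in>?E. seq_count A y) +
      ((\<Sum>(m, m')\<in>?L. seq_shift_count A x (a ^ v m' - a ^ v m)) +
       (\<Sum>(m, m')\<in>?L. seq_shift_count A x (a ^ v m' - a ^ v m)))"
    unfolding total R by (intro add_mono E L)
  then show ?thesis
    by (simp only: sum_constant of_nat_id mult_2 mult.commute)
qed

text \<open>Since \<open>card\<close> is 0 on infinite sets, bounding \<open>repr_count\<close> from
  below by a subset requires this finiteness. Both k \<le> A k and w < a^w confine the solutions,
  and \<open>f\<close> takes each value finitely often.\<close>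

lemma finite_representations:
  fixes A :: "nat \<Rightarrow> nat" and f :: "int poly"
  assumes A: "pos_strict_seq A" and a: "a \<ge> 2" and f: "degree f \<ge> 1"
    and pos: "\<And>m::nat. m \<ge> 1 \<Longrightarrow> poly f (int m) \<ge> 1"
  shows "finite {(k, m). k \<ge> 1 \<and> m \<ge> 1 \<and> A k + a ^ nat (poly f (int m)) = n}"
proof (rule finite_subset)
  show "{(k, m). k \<ge> 1 \<and> m \<ge> 1 \<and> A k + a ^ nat (poly f (int m)) = n}
    \<subseteq> {..n} \<times> (\<Union>w\<in>{..n}. {m. poly f (int m) = int w})"
  proof safe
    fix k m :: nat
    assume km: "k \<ge> 1" "m \<ge> 1" and n: "n = A k + a ^ nat (poly f (int m))"
    show "k \<le> A k + a ^ nat (poly f (int m))"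
      using pos_strict_seq_ge[OF A km(1)] by simp
    have "nat (poly f (int m)) < a ^ nat (poly f (int m))"
      using a by (intro power_gt_expt) simp
    then have "nat (poly f (int m)) \<le> A k + a ^ nat (poly f (int m))" by simp
    then show "m \<in> (\<Union>w\<in>{..A k + a ^ nat (poly f (int m))}. {m. poly f (int m) = int w})"
      using pos[OF km(2)] by (intro UN_I[of "nat (poly f (int m))"]) auto
  qed
  show "finite ({..n} \<times> (\<Union>w\<in>{..n}. {m. poly f (int m) = int w}))"
    using finite_poly_eq[OF refl f] by simp
qed

lemma seq_count_mono:
  assumes "pos_strict_seq A" "x \<le> y"
  shows "seq_count A x \<le> seq_count A y"
  unfolding seq_count_def
  using assms(2) by (intro card_mono pos_strict_seq_finite[OF assms(1)]) auto

text \<open>\<open>nat\<close> is injective on the positive values of \<open>f\<close>, and each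
  value is attained at most \<open>d\<close> times.\<close>

lemma card_equal_values_le:
  fixes f :: "int poly"
  assumes f: "degree f = d" "d \<ge> 1" and pos: "\<And>m::nat. m \<ge> 1 \<Longrightarrow> poly f (int m) \<ge> 1"
  shows "card {(m, m'). m \<in> {1..N} \<and> m' \<in> {1..N} \<and> nat (poly f (int m)) = nat (poly f (int m'))}
    \<le> d * N"
proof -
  let ?R = "\<lambda>m. {m'. poly f (int m') = poly f (int m)}"
  have "card {(m, m'). m \<in> {1..N} \<and> m' \<in> {1..N} \<and> nat (poly f (int m)) = nat (poly f (int m'))}
    \<le> card (Sigma {1..N} ?R)"
  proof (rule card_mono)
    show "finite (Sigma {1..N} ?R)" using finite_poly_eq[OF f] by auto
    show "{(m, m'). m \<in> {1..N} \<and> m' \<in> {1..N} \<and> nat (poly f (int m)) = nat (poly f (int m'))}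
      \<subseteq> Sigma {1..N} ?R"
    proof safe
      fix m m' assume "m \<in> {1..N}" "m' \<in> {1..N}" "nat (poly f (int m)) = nat (poly f (int m'))"
      then show "poly f (int m') = poly f (int m)"
        using pos[of m] pos[of m'] by simp
    qed
  qed
  also have "\<dots> = (\<Sum>m\<in>{1..N}. card (?R m))"
    using finite_poly_eq[OF f] by (intro card_SigmaI) auto
  also have "\<dots> \<le> (\<Sum>m\<in>{1..N}. d)"
    by (intro sum_mono card_poly_eq_le[OF f])
  finally show ?thesis by (simp add: mult.commute)
qed

section \<open>Choice of parameters and conclusion\<close>

theorem theorem1p2:
  fixes a d :: nat and f :: "int poly" and K1 K2 K3 K4 :: real
  assumes "K1 > 0" and "K2 > 0" and "K3 > 0" and "K4 > 0"
    and "a \<ge> 2"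
    and "degree f = d" and "d \<ge> 1"
    and "lead_coeff f > 0"
    and "content f = 1"
    and "\<forall>m::nat. m \<ge> 1 \<longrightarrow> poly f (int m) \<ge> 1"
  shows "\<exists>x0 c1 c2 :: real. x0 \<ge> 2 \<and> c1 > 0 \<and> c2 > 0 \<and>
    (\<forall>(\<eta> :: real \<Rightarrow> real) (A :: nat \<Rightarrow> nat).
       (\<forall>x\<ge>2. \<eta> x > 0) \<longrightarrow>
       pos_strict_seq A \<longrightarrow>
       (\<forall>x\<ge>2. K1 * x / \<eta> x \<le> real (seq_count A x) \<and> real (seq_count A x) \<le> K2 * x / \<eta> x) \<longrightarrow>
       (\<forall>x\<ge>2. real (seq_count A (x / 2)) \<ge> K3 * real (seq_count A x)) \<longrightarrow>
       (\<forall>x\<ge>2. \<forall>r::nat. r \<ge> 1 \<longrightarrow>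
          real (seq_shift_count A x r) \<le> K4 * (real r / real (totient r)) * (x / (\<eta> x)\<^sup>2)) \<longrightarrow>
       (\<forall>x\<ge>x0.
          real (card {n::nat. n \<ge> 1 \<and> real n \<le> x \<and>
                  real (repr_count A a f n) \<ge> c1 * (ln x powr (1 / real d) / \<eta> x)})
          \<ge> c2 * x * (ln x powr (1 / real d) / (ln x powr (1 / real d) + \<eta> x))))"
proof -
  note K = assms(1-4) and a = assms(5) and f = assms(6,7)
  have pos: "\<And>m::nat. m \<ge> 1 \<Longrightarrow> poly f (int m) \<ge> 1" using assms(10) by blast
  define v where "v = (\<lambda>m::nat. nat (poly f (int m)))"
  obtain C where C: "C > 0"
    "\<And>N. N \<ge> 1 \<Longrightarrow> (\<Sum>(m, m') | m \<in> {1..N} \<and> m' \<in> {1..N} \<and> v m < v m'.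
      real (a ^ v m' - a ^ v m) / real (totient (a ^ v m' - a ^ v m))) \<le> C * real N ^ 2"
    using sum_over_totient_power_diff_le[OF a f pos] unfolding v_def by blast
  obtain B where B: "B \<ge> 1" "\<And>m::nat. m \<ge> 1 \<Longrightarrow> poly f (int m) \<le> int (B * m ^ d)"
    using poly_le_power[of f] f(1) by blast
  have lna: "ln (real a) > 0" using a by simp
  \<comment> \<open>For m \<le> N the exponent f(m) is at most B N^d \<le> B q ln x = ln x / (2 ln
    a), so a^f(m) is at most the square root of \<open>x\<close>.\<close>
  define q where "q = 1 / (2 * real B * ln (real a))"
  have q: "q > 0" using B(1) lna by (simp add: q_def)
  define c0 where "c0 = q powr (1 / real d)"
  have c0: "c0 > 0" using q by (simp add: c0_def)
  \<comment> \<open>The first summand comes from pairs with f(m) = f(m'), the second from all other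
    pairs.\<close>
  define V0 where "V0 = real d * K2 + 2 * K4 * C"
  have V0: "V0 > 0" using K C(1) by (simp add: V0_def add_nonneg_pos)
  \<comment> \<open>Makes b (ln x)^(1/d) at most both N and (ln x)^(1/d), for the final
    comparison.\<close>
  define b where "b = min 1 (c0 / 2)"
  have b: "b > 0" "b \<le> 1" "b \<le> c0 / 2" using c0 by (auto simp: b_def)
  show ?thesis
  proof (intro exI conjI allI impI)
    \<comment> \<open>From exp(1/q) comes q ln x \<ge> 1 and hence N \<ge> 1; from 4 comes that the
      square root of \<open>x\<close> is at most x/2.\<close>
    show "max 4 (exp (1 / q)) \<ge> 2" by simp
    show "K1 * K3 * c0 / 4 > 0" using K c0 by simp
    show "(K1 * K3)\<^sup>2 * b / (4 * V0) > 0" using K b V0 by simp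
  next
    fix \<eta> :: "real \<Rightarrow> real" and A :: "nat \<Rightarrow> nat" and x :: real
    assume \<eta>: "\<forall>x\<ge>2. \<eta> x > 0" and A: "pos_strict_seq A"
      and count: "\<forall>x\<ge>2. K1 * x / \<eta> x \<le> real (seq_count A x) \<and> real (seq_count A x) \<le> K2 * x / \<eta> x"
      and half: "\<forall>x\<ge>2. real (seq_count A (x / 2)) \<ge> K3 * real (seq_count A x)"
      and shift: "\<forall>x\<ge>2. \<forall>r::nat. r \<ge> 1 \<longrightarrow>
          real (seq_shift_count A x r) \<le> K4 * (real r / real (totient r)) * (x / (\<eta> x)\<^sup>2)"
      and "x \<ge> max 4 (exp (1 / q))"
    then have x: "x \<ge> 4" "x \<ge> exp (1 / q)" by auto
    have "ln (exp (1 / q)) \<le> ln x" using x by (subst ln_le_cancel_iff) auto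
    then have lnx: "q * ln x \<ge> 1" "ln x > 0" using q x by (simp_all add: field_simps)
    define e where "e = \<eta> x"
    have e: "e > 0" using \<eta> x by (simp add: e_def)
    define \<Lambda> where "\<Lambda> = ln x powr (1 / real d)"
    have \<Lambda>: "\<Lambda> > 0" using lnx by (simp add: \<Lambda>_def)
    have c0\<Lambda>: "c0 * \<Lambda> = (q * ln x) powr (1 / real d)"
      using q lnx by (simp add: c0_def \<Lambda>_def powr_mult)
    \<comment> \<open>Rounding down loses at most a factor 2, because c0 \<Lambda> \<ge> 1.\<close>
    define N where "N = nat \<lfloor>c0 * \<Lambda>\<rfloor>"
    have "c0 * \<Lambda> \<ge> 1" unfolding c0\<Lambda> using lnx by (intro ge_one_powr_ge_zero) auto
    then have "\<lfloor>c0 * \<Lambda>\<rfloor> \<ge> 1" by simp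
    then have N1: "N \<ge> 1" and "real N = real_of_int \<lfloor>c0 * \<Lambda>\<rfloor>" unfolding N_def by linarith+
    then have N: "N \<ge> 1" "real N \<le> c0 * \<Lambda>" "c0 * \<Lambda> / 2 \<le> real N"
      using real_of_int_floor_add_one_gt[of "c0 * \<Lambda>"] of_int_floor_le[of "c0 * \<Lambda>"]
      by linarith+
    have small: "real (a ^ v m) \<le> x / 2" if m: "m \<in> {1..N}" for m
    proof -
      have "int (v m) \<le> int (B * m ^ d)"
        using B(2)[of m] pos[of m] m by (simp add: v_def)
      then have "v m \<le> B * m ^ d" by (simp only: of_nat_le_iff)
      also have "\<dots> \<le> B * N ^ d" using m by (intro mult_left_mono power_mono) auto
      finally have "real (v m) \<le> real (B * N ^ d)" by (simp only: of_nat_le_iff)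
      also have "\<dots> \<le> real B * (c0 * \<Lambda>) ^ d"
        using N(2) by (simp add: mult_left_mono power_mono)
      also have "(c0 * \<Lambda>) ^ d = q * ln x"
        unfolding c0\<Lambda> using q lnx f(2) by (simp add: powr_power)
      finally have "real (v m) * ln (real a) \<le> real B * (q * ln x) * ln (real a)"
        using lna by (intro mult_right_mono) auto
      also have "\<dots> = ln x / 2" using B(1) lna by (simp add: q_def)
      finally have "exp (real (v m) * ln (real a)) \<le> exp (ln x / 2)" by simp
      moreover have "exp (real (v m) * ln (real a)) = real (a ^ v m)"
        using a by (simp add: exp_of_nat_mult)
      moreover have "exp (ln x / 2) \<le> x / 2"
      proof -
        define s where "s = exp (ln x / 2)"
        have s: "s * s = x" "s > 0" using x by (simp_all add: s_def flip: exp_add)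
        then have "s \<ge> 2" using x mult_strict_mono[of s 2 s 2] by (cases "s < 2") auto
        then have "2 * s \<le> s * s" using s by (intro mult_right_mono) auto
        then have "s \<le> x / 2" using s(1) by linarith
        then show ?thesis unfolding s_def .
      qed
      ultimately show ?thesis by simp
    qed
    define P where "P = {k. k \<ge> 1 \<and> real (A k) \<le> x / 2}"
    define X where "X = P \<times> {1..N}"
    define g where "g = (\<lambda>(k, m). A k + a ^ v m)"
    have finP: "finite P" unfolding P_def by (rule pos_strict_seq_finite[OF A])
    have cardP: "card P = seq_count A (x / 2)" by (simp add: P_def seq_count_def)
    \<comment> \<open>Up to constants, the mean number of representations of n \<le> x by elements
      of \<open>X\<close>. The second moment quotient M^2/V is then a constant times x Y/(1 +
      Y).\<close>
    define Y where "Y = real N / e"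
    have Y: "Y > 0" using N(1) e by (simp add: Y_def)
    define M where "M = K1 * K3 * x * Y"
    define V where "V = V0 * x * (Y + Y\<^sup>2)"
    have xpos: "x > 0" using x by simp
    have MV: "M > 0" "V > 0" using K V0 Y xpos by (simp_all add: M_def V_def add_pos_pos)
    have P_lower: "K3 * (K1 * x / e) \<le> real (card P)"
    proof -
      have "K3 * (K1 * x / e) \<le> K3 * real (seq_count A x)"
        using count x K by (intro mult_left_mono) (auto simp: e_def)
      also have "\<dots> \<le> real (card P)" using half x by (simp add: cardP)
      finally show ?thesis .
    qed
    have P_upper: "real (card P) \<le> K2 * x / e"
    proof -
      have "card P \<le> seq_count A x"
        unfolding cardP using xpos by (intro seq_count_mono[OF A]) simp
      moreover have "real (seq_count A x) \<le> K2 * x / e" using count x by (simp add: e_def)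
      ultimately show ?thesis by linarith
    qed
    have first: "M \<le> real (card X)"
    proof -
      have "M = K3 * (K1 * x / e) * real N" by (simp add: M_def Y_def)
      also have "\<dots> \<le> real (card P) * real N" by (intro mult_right_mono P_lower) simp
      finally show ?thesis by (simp add: X_def card_cartesian_product)
    qed
    have second: "real (card {(u, u'). u \<in> X \<and> u' \<in> X \<and> g u = g u'}) \<le> V"
    proof -
      let ?E = "{(m, m'). m \<in> {1..N} \<and> m' \<in> {1..N} \<and> v m = v m'}"
      let ?L = "{(m, m'). m \<in> {1..N} \<and> m' \<in> {1..N} \<and> v m < v m'}"
      define sh where "sh = (\<Sum>(m, m')\<in>?L. seq_shift_count A x (a ^ v m' - a ^ v m))"
      have "card {(u, u'). u \<in> X \<and> u' \<in> X \<and> g u = g u'} \<le> card P * card ?E + 2 * sh"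
        using card_equal_sums_le[OF A _ a, of "x / 2" x N v] xpos
        unfolding X_def P_def g_def sh_def seq_count_def by simp
      also have "\<dots> \<le> card P * (d * N) + 2 * sh"
        using card_equal_values_le[OF f pos, of N] unfolding v_def
        by (intro add_mono mult_left_mono) auto
      finally have "real (card {(u, u'). u \<in> X \<and> u' \<in> X \<and> g u = g u'})
          \<le> real (card P * (d * N) + 2 * sh)"
        by (rule of_nat_mono)
      also have "\<dots> = real (card P) * (real d * real N) + 2 * real sh" by simp
      also have "real (card P) * (real d * real N) \<le> K2 * x / e * (real d * real N)"
        by (intro mult_right_mono P_upper) simp
      also have "K2 * x / e * (real d * real N) = real d * K2 * x * Y" by (simp add: Y_def)
      also have "real sh \<le> K4 * (x / e\<^sup>2) * (C * real N ^ 2)"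
      proof -
        have "real sh = (\<Sum>(m, m')\<in>?L. real (seq_shift_count A x (a ^ v m' - a ^ v m)))"
          by (simp add: sh_def case_prod_unfold)
        also have "\<dots> \<le> (\<Sum>(m, m')\<in>?L. K4 * (x / e\<^sup>2) *
            (real (a ^ v m' - a ^ v m) / real (totient (a ^ v m' - a ^ v m))))"
        proof (rule sum_mono, clarify)
          fix m m' assume "v m < v m'"
          then have "a ^ v m < a ^ v m'" using a by simp
          then have "a ^ v m' - a ^ v m \<ge> 1" by simp
          then have "real (seq_shift_count A x (a ^ v m' - a ^ v m)) \<le>
              K4 * (real (a ^ v m' - a ^ v m) / real (totient (a ^ v m' - a ^ v m))) * (x / (\<eta> x)\<^sup>2)"
            by (intro shift[rule_format]) (use x(1) in auto)
          then show "real (seq_shift_count A x (a ^ v m' - a ^ v m)) \<le> K4 * (x / e\<^sup>2) *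
              (real (a ^ v m' - a ^ v m) / real (totient (a ^ v m' - a ^ v m)))"
            by (simp only: e_def mult_ac)
        qed
        also have "\<dots> = K4 * (x / e\<^sup>2) * (\<Sum>(m, m')\<in>?L.
            real (a ^ v m' - a ^ v m) / real (totient (a ^ v m' - a ^ v m)))"
          by (simp only: sum_distrib_left case_prod_unfold)
        also have "\<dots> \<le> K4 * (x / e\<^sup>2) * (C * real N ^ 2)"
          using K xpos by (intro mult_left_mono C(2) N(1)) auto
        finally show ?thesis .
      qed
      also have "K4 * (x / e\<^sup>2) * (C * real N ^ 2) = K4 * C * x * Y\<^sup>2"
        by (simp add: Y_def power_divide)
      finally have "real (card {(u, u'). u \<in> X \<and> u' \<in> X \<and> g u = g u'})
          \<le> real d * K2 * x * Y + 2 * (K4 * C * x * Y\<^sup>2)" by simp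
      \<comment> \<open>The cross terms are added so that \<open>V\<close> factors as V0 x Y (1 +
        Y).\<close>
      also have "\<dots> \<le> V"
      proof -
        have "V = real d * K2 * x * Y + 2 * (K4 * C * x * Y\<^sup>2) + (real d * K2 * x * Y\<^sup>2 + 2 * K4 * C * x * Y)"
          by (simp add: V_def V0_def algebra_simps)
        moreover have "real d * K2 * x * Y\<^sup>2 + 2 * K4 * C * x * Y \<ge> 0"
          using K C(1) xpos Y by simp
        ultimately show ?thesis by linarith
      qed
      finally show ?thesis .
    qed
    have "g u \<ge> 1 \<and> real (g u) \<le> x" if "u \<in> X" for u
    proof -
      from that obtain k m where u: "u = (k, m)" "k \<in> P" "m \<in> {1..N}" by (auto simp: X_def)
      then have "real (A k) \<le> x / 2" "real (a ^ v m) \<le> x / 2" "a ^ v m \<ge> 1"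
        using small[of m] a by (auto simp: P_def)
      then have "real (A k + a ^ v m) \<le> x" by (simp only: of_nat_add)
      then show ?thesis using \<open>a ^ v m \<ge> 1\<close> by (simp add: u(1) g_def)
    qed
    then have "M\<^sup>2 / (4 * V)
        \<le> real (card {n. n \<ge> 1 \<and> real n \<le> x \<and> M / (2 * x) \<le> real (card {u \<in> X. g u = n})})"
      using finP xpos MV first second by (intro card_large_fibres_ge) (auto simp: X_def)
    also have "\<dots> \<le> real (card {n. n \<ge> 1 \<and> real n \<le> x \<and>
        real (repr_count A a f n) \<ge> K1 * K3 * c0 / 4 * (\<Lambda> / e)})"
    proof (intro of_nat_mono card_mono subsetI)
      show "finite {n. n \<ge> 1 \<and> real n \<le> x \<and>
        real (repr_count A a f n) \<ge> K1 * K3 * c0 / 4 * (\<Lambda> / e)}"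
        by (rule finite_subset[of _ "{..nat \<lfloor>x\<rfloor>}"]) (auto simp: le_nat_floor)
    next
      fix n assume "n \<in> {n. n \<ge> 1 \<and> real n \<le> x \<and> M / (2 * x) \<le> real (card {u \<in> X. g u = n})}"
      then have n: "n \<ge> 1" "real n \<le> x" "M / (2 * x) \<le> real (card {u \<in> X. g u = n})" by auto
      have "card {u \<in> X. g u = n} \<le> repr_count A a f n"
        unfolding repr_count_def
        using f(2) unfolding f(1)[symmetric]
        by (intro card_mono finite_representations[OF A a _ pos]) (auto simp: X_def P_def g_def v_def)
      \<comment> \<open>The threshold M/(2x) is K1 K3 N/(2e); the bound N \<ge> c0 \<Lambda>/2
        accounts for the denominator 4.\<close>
      moreover have "K1 * K3 * c0 / 4 * (\<Lambda> / e) \<le> M / (2 * x)"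
      proof -
        have "K1 * K3 * c0 / 4 * (\<Lambda> / e) = K1 * K3 / (2 * e) * (c0 * \<Lambda> / 2)" by simp
        also have "\<dots> \<le> K1 * K3 / (2 * e) * real N"
          using N(3) K e by (intro mult_left_mono) auto
        also have "\<dots> = M / (2 * x)" using xpos by (simp add: M_def Y_def)
        finally show ?thesis .
      qed
      ultimately show "n \<in> {n. n \<ge> 1 \<and> real n \<le> x \<and>
        real (repr_count A a f n) \<ge> K1 * K3 * c0 / 4 * (\<Lambda> / e)}"
        using n by simp
    qed
    finally have main: "M\<^sup>2 / (4 * V) \<le> real (card {n. n \<ge> 1 \<and> real n \<le> x \<and>
        real (repr_count A a f n) \<ge> K1 * K3 * c0 / 4 * (\<Lambda> / e)})" .
    have "(K1 * K3)\<^sup>2 * b / (4 * V0) * x * (\<Lambda> / (\<Lambda> + e))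
        = (K1 * K3)\<^sup>2 * x / (4 * V0) * (b * \<Lambda> / (e + \<Lambda>))"
      by (simp add: add.commute)
    also have "\<dots> \<le> (K1 * K3)\<^sup>2 * x / (4 * V0) * (real N / (e + real N))"
    proof (rule mult_left_mono)
      have "b * \<Lambda> \<le> \<Lambda>"
        using b(2) \<Lambda> by simp
      have "b * \<Lambda> \<le> c0 / 2 * \<Lambda>"
        using \<Lambda> by (intro mult_right_mono b(3)) simp
      then have "b * \<Lambda> \<le> real N" using N(3) by simp
      \<comment> \<open>First b \<le> 1 shrinks the denominator; then t/(e + t), increasing in t, is
        compared at b \<Lambda> \<le> N.\<close>
      have "b * \<Lambda> / (e + \<Lambda>) \<le> b * \<Lambda> / (e + b * \<Lambda>)"
        using b \<Lambda> e \<open>b * \<Lambda> \<le> \<Lambda>\<close> by (intro divide_left_mono) (auto intro!: mult_pos_pos add_pos_pos)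
      also have "\<dots> \<le> real N / (e + real N)"
      proof -
        have "b * \<Lambda> * e \<le> real N * e"
          using \<open>b * \<Lambda> \<le> real N\<close> e by (intro mult_right_mono) auto
        moreover have "b * \<Lambda> > 0" using b(1) \<Lambda> by simp
        ultimately show ?thesis
          using e by (simp add: divide_le_eq le_divide_eq add_pos_nonneg algebra_simps)
      qed
      finally show "b * \<Lambda> / (e + \<Lambda>) \<le> real N / (e + real N)" .
    qed (use K V0 xpos in auto)
    also have "real N / (e + real N) = Y / (1 + Y)"
      using e N(1) by (simp add: Y_def field_simps)
    also have "(K1 * K3)\<^sup>2 * x / (4 * V0) * (Y / (1 + Y)) = M\<^sup>2 / (4 * V)"
    proof -
      have "V = V0 * x * Y * (1 + Y)" by (simp add: V_def power2_eq_square algebra_simps)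
      moreover have "M\<^sup>2 = (K1 * K3)\<^sup>2 * x * Y * (x * Y)"
        by (simp add: M_def power2_eq_square)
      moreover have "1 + Y > 0" using Y by simp
      ultimately show ?thesis
        using xpos Y V0 by simp
    qed
    finally show "(K1 * K3)\<^sup>2 * b / (4 * V0) * x * (ln x powr (1 / real d) / (ln x powr (1 / real d) + \<eta> x))
        \<le> real (card {n. n \<ge> 1 \<and> real n \<le> x \<and>
          real (repr_count A a f n) \<ge> K1 * K3 * c0 / 4 * (ln x powr (1 / real d) / \<eta> x)})"
      using main unfolding \<Lambda>_def e_def by linarith
  qed
qed

end
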